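(* Let $N>1$ be an integer, $\mathcal{X}$ a Euclidean space and $\beta\in(0,+\infty)$. For each $n=1,\dots,N$ let $f_n$ be a convex differentiable function on $\mathcal{X}$ whose gradient is $1/\beta$-Lipschitz continuous on $\mathcal{X}$, and let $g_n\in\Gamma_0(\mathcal{X})$. Assume that the infimum of $$\inf_{x\in\mathcal{X}}\sum_{n=1}^{N}\big(f_n(x)+g_n(x)\big)$$ is attained and that $\bigcap_{n=1}^N \mathrm{ri}\,\mathrm{dom}\,g_n\neq\emptyset$. Let $(\zeta^k)_{k\ge1}$ be an i.i.d. sequence of random variables with values in $\{1,\dots,N\}$ such that $\mathbb{P}[\zeta^1=n]>0$ for all $n=1,\dots,N$. Suppose $0<\gamma<2\beta$ and $0<\lambda\le 1/2$. Let $v^0,y^0,x^0\in\mathcal{X}^N$ be any initial point, and let $(v^k,y^k,x^k)_{k\ge0}$ be generated by the SMSPDFP$^2$O algorithm: for $k\ge0$, set $$s^k=\frac1N\sum_{n=1}^{N}\big(x^{k}_{n}-\gamma\nabla f_{n}(x^{k}_{n})-\lambda y^{k}_{n}\big),\qquad \bar v^k=\frac1N\sum_{n=1}^N v^k_n;$$ for $n=\zeta^{k+1}$ set $$ \begin{aligned} v^{k+1}_{n}&=x^{k}_{n}-\gamma\nabla f_{n}(x^{k}_{n})+(1-\lambda)v^{k}_{n}-\lambda y^{k}_{n}-\big(s^k+(1-\lambda)\bar v^k\big),\\ y^{k+1}_{n}&=(I-\mathrm{prox}_{\frac{\gamma}{\lambda}g_{n}})\big(x^{k}_{n}-\gamma\nabla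 f_{n}(x^{k}_{n})+(1-\lambda)y^{k}_{n}-\lambda v^{k}_{n}\big),\\ x^{k+1}_{n}&=x^{k}_{n}-\gamma\nabla f_{n}(x^{k}_{n})-\lambda v^{k+1}_{n}-\lambda y^{k+1}_{n}; \end{aligned} $$ and for all $n\neq\zeta^{k+1}$ set $v^{k+1}_n=v^k_n$, $y^{k+1}_n=y^k_n$, $x^{k+1}_n=x^k_n$. Then, almost surely, the sequence $\bar x^k=\frac1N\sum_{n=1}^N x^k_n$ converges to a minimizer of $\sum_{n=1}^{N}(f_n+g_n)$ over $\mathcal{X}$ (equivalently, $(\bar x^k,\dots,\bar x^k)\in\mathcal{X}^N$ converges to a minimizer over $x\in\mathcal{X}^N$ of $\sum_{n=1}^N(f_n(x_n)+g_n(x_n))+\iota_{\mathcal{C}}(x)$).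
   Context: $\Gamma_0(\mathcal{X})$ denotes the set of proper lower semicontinuous convex functions $\mathcal{X}\to(-\infty,+\infty]$. For $\varphi\in\Gamma_0(\mathcal{X})$, $\mathrm{prox}_\varphi(x)=\arg\min_{y\in\mathcal{X}}\ \varphi(y)+\frac12\|x-y\|^2$. $I$ is the identity, $\mathrm{ri}$ denotes relative interior, $\mathrm{dom}$ the effective domain. A vector $x\in\mathcal{X}^N$ has components $x_1,\dots,x_N\in\mathcal{X}$. $\mathcal{C}=\{x\in\mathcal{X}^N: x_1=\cdots=x_N\}$, and $\iota_{\mathcal{C}}$ is its indicator function ($0$ on $\mathcal{C}$, $+\infty$ elsewhere). *)

theory Defs
  imports "HOL-Probability.Probability"
begin

text \<open>
  The index set \<open>{1,\<dots>,N}\<close> is a finite type \<open>'n\<close> with \<open>N = CARD('n)\<close>, and the product space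
  \<open>X^N\<close> is \<open>'a ^ 'n\<close> with \<open>'a\<close> a Euclidean space.
\<close>

definition eff_dom :: "('a \<Rightarrow> ereal) \<Rightarrow> 'a set" where
  "eff_dom \<phi> = {x. \<phi> x < \<infinity>}"

definition proper_fun :: "('a \<Rightarrow> ereal) \<Rightarrow> bool" where
  "proper_fun \<phi> \<longleftrightarrow> (\<forall>x. \<phi> x \<noteq> -\<infinity>) \<and> eff_dom \<phi> \<noteq> {}"

definition lsc_fun :: "('a::topological_space \<Rightarrow> ereal) \<Rightarrow> bool" where
  "lsc_fun \<phi> \<longleftrightarrow> (\<forall>x. \<phi> x \<le> Liminf (at x) \<phi>)"

text \<open>The endpoints \<open>t = 0, 1\<close> are harmless because \<open>0 * \<infinity> = 0\<close> in \<^typ>\<open>ereal\<close>.\<close>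

definition convex_fun :: "('a::real_vector \<Rightarrow> ereal) \<Rightarrow> bool" where
  "convex_fun \<phi> \<longleftrightarrow>
     (\<forall>x y. \<forall>t\<in>{0..1}. \<phi> ((1 - t) *\<^sub>R x + t *\<^sub>R y) \<le> ereal (1 - t) * \<phi> x + ereal t * \<phi> y)"

definition Gamma0 :: "('a::euclidean_space \<Rightarrow> ereal) set" where
  "Gamma0 = {\<phi>. proper_fun \<phi> \<and> lsc_fun \<phi> \<and> convex_fun \<phi>}"

text \<open>Single-valued: for \<open>\<phi> \<in> Gamma0\<close> the minimizer exists and is unique.\<close>

definition prox :: "('a::euclidean_space \<Rightarrow> ereal) \<Rightarrow> 'a \<Rightarrow> 'a" where
  "prox \<phi> x = (ARG_MIN (\<lambda>y. \<phi> y + ereal (1/2 * (norm (x - y))\<^sup>2)) y. True)"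

definition grad :: "('a::euclidean_space \<Rightarrow> real) \<Rightarrow> 'a \<Rightarrow> 'a" where
  "grad f x = (THE d. GDERIV f x :> d)"

definition minimizer :: "('b \<Rightarrow> ereal) \<Rightarrow> 'b \<Rightarrow> bool" where
  "minimizer F x \<longleftrightarrow> is_arg_min F (\<lambda>_. True) x"

definition avg :: "'a::euclidean_space ^ 'n \<Rightarrow> 'a" where
  "avg x = (1 / real CARD('n)) *\<^sub>R (\<Sum>n\<in>UNIV. x $ n)"

definition consensus :: "('a ^ 'n) set" where
  "consensus = {x. \<forall>m n. x $ m = x $ n}"

definition indicator_fun :: "'b set \<Rightarrow> 'b \<Rightarrow> ereal" where
  "indicator_fun C x = (if x \<in> C then 0 else \<infinity>)"

definition objective ::
    "('n::finite \<Rightarrow> 'a \<Rightarrow> real) \<Rightarrow> ('n \<Rightarrow> 'a \<Rightarrow> ereal) \<Rightarrow> 'a \<Rightarrow> ereal" where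
  "objective f g x = (\<Sum>n\<in>UNIV. ereal (f n x) + g n x)"

definition product_objective ::
    "('n::finite \<Rightarrow> 'a \<Rightarrow> real) \<Rightarrow> ('n \<Rightarrow> 'a \<Rightarrow> ereal) \<Rightarrow> 'a ^ 'n \<Rightarrow> ereal" where
  "product_objective f g x =
     (\<Sum>n\<in>UNIV. ereal (f n (x $ n)) + g n (x $ n)) + indicator_fun consensus x"

text \<open>
  The algorithm along one realization \<open>\<zeta>\<close> of the index sequence, of which only the values
  \<open>\<zeta> 1, \<zeta> 2, \<dots>\<close> are used. The update of \<open>x\<close> uses the new values of \<open>v\<close> and \<open>y\<close>.
\<close>

definition smspdfp2o ::
    "real \<Rightarrow> real \<Rightarrow> ('n::finite \<Rightarrow> 'a::euclidean_space \<Rightarrow> real) \<Rightarrow> ('n \<Rightarrow> 'a \<Rightarrow> ereal) \<Rightarrow> (nat \<Rightarrow> 'n)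
      \<Rightarrow> (nat \<Rightarrow> 'a ^ 'n) \<Rightarrow> (nat \<Rightarrow> 'a ^ 'n) \<Rightarrow> (nat \<Rightarrow> 'a ^ 'n) \<Rightarrow> bool" where
  "smspdfp2o \<gamma> lam f g \<zeta> v y x \<longleftrightarrow>
     (\<forall>k n.
        if n = \<zeta> (Suc k) then
          (let w = x k $ n - \<gamma> *\<^sub>R grad (f n) (x k $ n);
               s = avg (\<chi> m. x k $ m - \<gamma> *\<^sub>R grad (f m) (x k $ m) - lam *\<^sub>R y k $ m);
               z = w + (1 - lam) *\<^sub>R y k $ n - lam *\<^sub>R v k $ n
           in v (Suc k) $ n =
                w + (1 - lam) *\<^sub>R v k $ n - lam *\<^sub>R y k $ n - (s + (1 - lam) *\<^sub>R avg (v k)) \<and>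
              y (Suc k) $ n = z - prox (\<lambda>u. ereal (\<gamma> / lam) * g n u) z \<and>
              x (Suc k) $ n = w - lam *\<^sub>R v (Suc k) $ n - lam *\<^sub>R y (Suc k) $ n)
        else
          v (Suc k) $ n = v k $ n \<and> y (Suc k) $ n = y k $ n \<and> x (Suc k) $ n = x k $ n)"

end

theory Submission
  imports Defs
begin

text \<open>
  One iteration replaces the block \<open>(v\<^sub>n, y\<^sub>n, x\<^sub>n)\<close>, \<open>n = \<zeta> (k + 1)\<close>, of the current state by the same
  block of the image under a deterministic operator \<open>T\<close>, whose fixed points have the form
  \<open>x\<^sub>1 = \<dots> = x\<^sub>N = u\<close> with \<open>u\<close> a minimizer; by the subdifferential sum rule every minimizer arises.
  With respect to a block-separable quadratic energy \<open>\<Sum>\<^sub>n Q(z\<^sub>n)\<close>, the operator \<open>T\<close> satisfies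
  \<open>\<Sum>\<^sub>n Q(T(z)\<^sub>n - w\<^sub>n) + c \<parallel>T z - z\<parallel>\<^sup>2 \<le> \<Sum>\<^sub>n Q(z\<^sub>n - w\<^sub>n)\<close> for every fixed point \<open>w\<close>. Weighting block \<open>n\<close> by
  \<open>1 / p\<^sub>n\<close> turns this into a supermartingale along the random iteration, with summable residuals.
  Hence almost surely the residuals vanish, and for all \<open>w\<close> in a countable dense set of fixed points
  the distance to \<open>w\<close> does not oscillate, so that the iterates have only one cluster point, a
  fixed point of \<open>T\<close>.
\<close>

subsection \<open>Supermartingales on the histories of an i.i.d. sequence\<close>

text \<open>Random blocks dictate the shape of the energy: the weights \<open>1 / p n\<close> cancel
  the selection probabilities only when the energy is a sum of per-block terms. The blocks are
  nevertheless coupled through the mean subtracted in the update of \<open>v\<close>, and the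
  inequality controlling that update holds only after summation over all blocks. The sum is exactly
  what the expectation over the drawn index produces.

  The index set is finite, so each random quantity is a function of the list of indices drawn so
  far. A supermartingale is then a family of inequalities on lists, and expectations are finite sums
  with product weights. Two probabilistic facts carry the proof, both resting on Fatou's lemma: a
  nonnegative supermartingale almost surely does not tend to infinity, and it does not cross
  infinitely often between two fixed levels. The exceptional null set depends on the fixed point and
  on the levels; hence the countable dense set of fixed points and the rational levels.\<close>

primrec hist :: "(nat \<Rightarrow> 'n) \<Rightarrow> nat \<Rightarrow> 'n list" where
  "hist s 0 = []"
| "hist s (Suc k) = s (Suc k) # hist s k"

lemma length_hist [simp]: "length (hist s k) = k"
  by (induction k) auto

locale iid_selection = prob_space M for M :: "'w measure" +
  fixes \<zeta> :: "nat \<Rightarrow> 'w \<Rightarrow> 'n::finite" and p :: "'n \<Rightarrow> real"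
  assumes indep: "indep_vars (\<lambda>_. count_space UNIV) \<zeta> {1..}"
    and ident: "\<And>k n. 1 \<le> k \<Longrightarrow> prob {\<omega> \<in> space M. \<zeta> k \<omega> = n} = p n"
begin

abbreviation history :: "nat \<Rightarrow> 'w \<Rightarrow> 'n list" where
  "history k \<omega> \<equiv> hist (\<lambda>i. \<zeta> i \<omega>) k"

lemma measurable_selection: "1 \<le> k \<Longrightarrow> \<zeta> k \<in> measurable M (count_space UNIV)"
  using indep unfolding indep_vars_def by auto

lemma p_nonneg: "0 \<le> p n"
  using ident[of 1 n] measure_nonneg by (metis order_refl)

lemma p_sum: "(\<Sum>n\<in>UNIV. p n) = 1"
proof -
  have m: "\<zeta> 1 \<in> measurable M (count_space UNIV)" by (rule measurable_selection) simp
  have "(\<Sum>n\<in>UNIV. p n) = (\<Sum>n\<in>UNIV. prob {\<omega> \<in> space M. \<zeta> 1 \<omega> = n})"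
    by (simp add: ident)
  also have "\<dots> = prob (\<Union>n\<in>UNIV. {\<omega> \<in> space M. \<zeta> 1 \<omega> = n})"
    by (rule finite_measure_finite_Union[symmetric])
      (use m in \<open>auto simp: disjoint_family_on_def\<close>)
  also have "(\<Union>n\<in>UNIV. {\<omega> \<in> space M. \<zeta> 1 \<omega> = n}) = space M" by auto
  finally show ?thesis by (simp add: prob_space)
qed

lemma measurable_history: "history k \<in> measurable M (count_space UNIV)"
proof (induction k)
  case 0 show ?case by simp
next
  case (Suc k)
  have [measurable]: "\<zeta> (Suc k) \<in> measurable M (count_space UNIV)"
    by (rule measurable_selection) simp
  note Suc[measurable]
  show ?case by simp
qed

lemma prob_history:
  "length s = k \<Longrightarrow> prob {\<omega> \<in> space M. history k \<omega> = s} = prod_list (map p s)"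
proof (cases "k = 0")
  case True
  moreover assume "length s = k"
  ultimately show ?thesis by (simp add: prob_space)
next
  case False
  assume len: "length s = k"
  \<comment> \<open>The newest draw stands first, so the draw at time \<open>j\<close> sits at
    position \<open>k - j\<close>.\<close>
  have hist_eq: "history k \<omega> = s \<longleftrightarrow> (\<forall>j\<in>{1..k}. \<zeta> j \<omega> = s ! (k - j))" if "length s = k" for k s \<omega>
    using that
  proof (induction k arbitrary: s)
    case (Suc k)
    then obtain n t where s: "s = n # t" "length t = k" by (cases s) auto
    have "(\<forall>j\<in>{1..Suc k}. \<zeta> j \<omega> = s ! (Suc k - j)) \<longleftrightarrow>
        \<zeta> (Suc k) \<omega> = n \<and> (\<forall>j\<in>{1..k}. \<zeta> j \<omega> = t ! (k - j))"
      by (auto simp: s atLeastAtMostSuc_conv Suc_diff_le)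
    with Suc.IH[OF s(2)] show ?case by (simp add: s)
  qed auto
  have prod_eq: "(\<Prod>j\<in>{1..k}. p (s ! (k - j))) = prod_list (map p s)" if "length s = k" for k s
    using that
  proof (induction k arbitrary: s)
    case (Suc k)
    then obtain n t where s: "s = n # t" "length t = k" by (cases s) auto
    have "(\<Prod>j\<in>{1..Suc k}. p (s ! (Suc k - j))) = p n * (\<Prod>j\<in>{1..k}. p (t ! (k - j)))"
      by (simp add: s atLeastAtMostSuc_conv Suc_diff_le)
    with Suc.IH[OF s(2)] show ?case by (simp add: s)
  qed auto
  have "{\<omega> \<in> space M. history k \<omega> = s} = (\<Inter>j\<in>{1..k}. \<zeta> j -` {s ! (k - j)} \<inter> space M)"
    using False by (auto simp: hist_eq[OF len] Suc_le_eq)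
  also have "prob \<dots> = (\<Prod>j\<in>{1..k}. prob (\<zeta> j -` {s ! (k - j)} \<inter> space M))"
    by (rule indep_varsD[OF indep]) (use False in auto)
  also have "\<dots> = (\<Prod>j\<in>{1..k}. p (s ! (k - j)))"
  proof (rule prod.cong)
    fix j assume "j \<in> {1..k}"
    then show "prob (\<zeta> j -` {s ! (k - j)} \<inter> space M) = p (s ! (k - j))"
      using ident[of j "s ! (k - j)"] by (simp add: vimage_def Int_def conj_commute)
  qed simp
  finally show ?thesis by (simp only: prod_eq[OF len])
qed

lemma nn_integral_history:
  fixes F :: "'n list \<Rightarrow> ennreal"
  shows "(\<integral>\<^sup>+\<omega>. F (history k \<omega>) \<partial>M) = (\<Sum>s | length s = k. F s * ennreal (prod_list (map p s)))"
proof -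
  note measurable_history[measurable]
  have fin: "finite {s :: 'n list. length s = k}"
    using finite_lists_length_eq[of "UNIV :: 'n set" k] by simp
  have "(\<integral>\<^sup>+\<omega>. F (history k \<omega>) \<partial>M) =
      (\<integral>\<^sup>+\<omega>. (\<Sum>s | length s = k. F s * indicator {\<omega> \<in> space M. history k \<omega> = s} \<omega>) \<partial>M)"
  proof (rule nn_integral_cong)
    fix \<omega> assume "\<omega> \<in> space M"
    then have "(\<Sum>s | length s = k. F s * indicator {\<omega> \<in> space M. history k \<omega> = s} \<omega>) =
       (\<Sum>s | length s = k. if s = history k \<omega> then F s else 0)"
      by (intro sum.cong) (auto simp: indicator_def)
    then show "F (history k \<omega>) = (\<Sum>s | length s = k. F s * indicator {\<omega> \<in> space M. history k \<omega> = s} \<omega>)"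
      using fin by simp
  qed
  also have "\<dots> = (\<Sum>s | length s = k. F s * emeasure M {\<omega> \<in> space M. history k \<omega> = s})"
    by (simp add: nn_integral_sum nn_integral_cmult_indicator)
  also have "\<dots> = (\<Sum>s | length s = k. F s * ennreal (prod_list (map p s)))"
    by (intro sum.cong) (auto simp: emeasure_eq_measure prob_history)
  finally show ?thesis .
qed

text \<open>The usual condition, conditioned on the list drawn so far: the average runs over the
  next index. It is imposed at every list, not just at almost every one, because the block iteration
  satisfies it pointwise.\<close>

definition supermartingale :: "('n list \<Rightarrow> real) \<Rightarrow> bool" where
  "supermartingale S \<longleftrightarrow> (\<forall>s. (\<Sum>n\<in>UNIV. p n * S (n # s)) \<le> S s)"

lemma nn_integral_supermartingale:
  assumes S: "supermartingale S" and nonneg: "\<And>s. 0 \<le> S s"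
  shows "(\<integral>\<^sup>+\<omega>. ennreal (S (history k \<omega>)) \<partial>M) \<le> ennreal (S [])"
proof -
  define E where "E k = (\<Sum>s | length s = k. S s * prod_list (map p s))" for k
  have pp: "0 \<le> prod_list (map p s)" for s
    by (induction s) (auto simp: p_nonneg)
  \<comment> \<open>Splitting off the newest index splits the factor \<open>p n\<close> off the
    product weight, so the supermartingale inequality applies at each older list.\<close>
  have "E (Suc k) \<le> E k" for k
  proof -
    have split: "{s :: 'n list. length s = Suc k} = (\<lambda>(s, n). n # s) ` ({s. length s = k} \<times> UNIV)"
      by (auto simp: length_Suc_conv image_iff)
    have "E (Suc k) = (\<Sum>(s, n)\<in>{s. length s = k} \<times> UNIV. S (n # s) * (p n * prod_list (map p s)))"
      unfolding E_def split
      by (subst sum.reindex) (auto simp: inj_on_def case_prod_unfold)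
    also have "\<dots> = (\<Sum>s | length s = k. \<Sum>n\<in>UNIV. S (n # s) * (p n * prod_list (map p s)))"
      by (rule sum.cartesian_product[symmetric])
    also have "\<dots> = (\<Sum>s | length s = k. (\<Sum>n\<in>UNIV. p n * S (n # s)) * prod_list (map p s))"
      by (simp add: sum_distrib_left sum_distrib_right mult_ac)
    also have "\<dots> \<le> E k"
      unfolding E_def using S
      by (intro sum_mono mult_right_mono pp) (auto simp: supermartingale_def)
    finally show ?thesis .
  qed
  then have "E k \<le> E 0" by (induction k) (auto intro: order_trans)
  also have "E 0 = S []" by (simp add: E_def)
  finally have "E k \<le> S []" .
  moreover have "(\<integral>\<^sup>+\<omega>. ennreal (S (history k \<omega>)) \<partial>M) = ennreal (E k)"
    by (simp add: nn_integral_history[where F = "\<lambda>s. ennreal (S s)"] E_def nonneg pp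
        flip: ennreal_mult sum_ennreal)
  ultimately show ?thesis by (simp add: ennreal_leI)
qed

text \<open>By Fatou's lemma the lower limit has expectation at most \<open>S []\<close>, hence is
  finite almost surely.\<close>

lemma supermartingale_not_to_infinity:
  assumes S: "supermartingale S" and nonneg: "\<And>s. 0 \<le> S s"
  shows "AE \<omega> in M. \<not> filterlim (\<lambda>k. S (history k \<omega>)) at_top sequentially"
proof -
  note measurable_history[measurable]
  have "(\<integral>\<^sup>+\<omega>. liminf (\<lambda>k. ennreal (S (history k \<omega>))) \<partial>M)
      \<le> liminf (\<lambda>k. \<integral>\<^sup>+\<omega>. ennreal (S (history k \<omega>)) \<partial>M)"
    by (rule nn_integral_liminf) simp
  also have "\<dots> \<le> ennreal (S [])"
    by (rule order_trans[OF Liminf_mono[where g = "\<lambda>_. ennreal (S [])"]])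
      (auto simp: nn_integral_supermartingale[OF S nonneg] Liminf_const)
  finally have "(\<integral>\<^sup>+\<omega>. liminf (\<lambda>k. ennreal (S (history k \<omega>))) \<partial>M) \<noteq> \<infinity>"
    by (auto simp: top_unique)
  then have "AE \<omega> in M. liminf (\<lambda>k. ennreal (S (history k \<omega>))) \<noteq> \<infinity>"
    by (intro nn_integral_PInf_AE) auto
  then show ?thesis
  proof (rule eventually_mono, intro notI)
    fix \<omega> assume fin: "liminf (\<lambda>k. ennreal (S (history k \<omega>))) \<noteq> \<infinity>"
      and "filterlim (\<lambda>k. S (history k \<omega>)) at_top sequentially"
    then have "((\<lambda>k. ennreal (S (history k \<omega>))) \<longlongrightarrow> \<infinity>) sequentially"
      by (simp add: ennreal_tendsto_top_eq_at_top)
    then show False using fin lim_imp_Liminf[OF sequentially_bot] by blast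
  qed
qed

end

text \<open>
  Capital of the strategy that holds one unit of \<open>X\<close> from each time its price is at most \<open>a\<close> until
  its price is next at least \<open>b\<close>; every completed round earns at least \<open>b - a\<close>.
\<close>

primrec holding :: "real \<Rightarrow> real \<Rightarrow> ('n list \<Rightarrow> real) \<Rightarrow> 'n list \<Rightarrow> bool" where
  "holding a b X [] \<longleftrightarrow> X [] \<le> a"
| "holding a b X (n # s) \<longleftrightarrow> X (n # s) \<le> a \<or> (X (n # s) < b \<and> holding a b X s)"

primrec capital :: "real \<Rightarrow> real \<Rightarrow> ('n list \<Rightarrow> real) \<Rightarrow> 'n list \<Rightarrow> real" where
  "capital a b X [] = a"
| "capital a b X (n # s) = capital a b X s + (if holding a b X s then X (n # s) - X s else 0)"

primrec rounds :: "real \<Rightarrow> real \<Rightarrow> ('n list \<Rightarrow> real) \<Rightarrow> 'n list \<Rightarrow> nat" where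
  "rounds a b X [] = 0"
| "rounds a b X (n # s) = rounds a b X s + (if holding a b X s \<and> b \<le> X (n # s) then 1 else 0)"

text \<open>The invariant behind Doob's upcrossing inequality. Buying replaces the term
  \<open>a\<close> by a price of at most \<open>a\<close>; selling replaces a price of at least
  \<open>b\<close> by \<open>a\<close> plus one more profit \<open>b - a\<close>; while the unit is
  held, both sides change by the same amount.\<close>

lemma capital_ge:
  assumes "a < b"
  shows "(if holding a b X s then X s else a) + (b - a) * rounds a b X s \<le> capital a b X s"
  using assms by (induction s) (auto simp: algebra_simps split: if_splits)

lemma rounds_to_infinity:
  assumes ab: "a < b"
    and low: "\<And>j. \<exists>k>j. X (hist \<sigma> k) \<le> a" and high: "\<And>j. \<exists>k>j. b \<le> X (hist \<sigma> k)"
  shows "filterlim (\<lambda>k. rounds a b X (hist \<sigma> k)) at_top sequentially"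
proof -
  let ?R = "\<lambda>k. rounds a b X (hist \<sigma> k)"
  have mono: "incseq ?R" by (rule incseq_SucI) simp
  have step: "\<exists>k. Suc (?R j) \<le> ?R k" for j
  proof -
    obtain k1 where k1: "k1 > j" "X (hist \<sigma> k1) \<le> a" using low by blast
    \<comment> \<open>First time at the upper level after \<open>k1\<close>. By minimality the unit
      is held from \<open>k1\<close> to \<open>k2 - 1\<close>, so a round is completed at
      \<open>k2\<close>.\<close>
    define k2 where "k2 = (LEAST k. k > k1 \<and> b \<le> X (hist \<sigma> k))"
    have k2: "k2 > k1" "b \<le> X (hist \<sigma> k2)"
      using LeastI_ex[OF high[of k1]] by (auto simp: k2_def)
    have below: "X (hist \<sigma> k) < b" if "k1 < k" "k < k2" for k
      using not_less_Least[of k "\<lambda>k. k > k1 \<and> b \<le> X (hist \<sigma> k)"] that by (auto simp: k2_def)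
    have hold: "k1 + i < k2 \<Longrightarrow> holding a b X (hist \<sigma> (k1 + i))" for i
    proof (induction i)
      case 0 show ?case using k1 by (cases k1) auto
    next
      case (Suc i) then show ?case using below[of "k1 + Suc i"] by auto
    qed
    obtain m where m: "k2 = Suc (k1 + m)" using less_imp_Suc_add[OF k2(1)] by auto
    have "?R k2 = Suc (?R (k1 + m))" using hold[of m] m k2(2) by simp
    moreover have "?R j \<le> ?R (k1 + m)" using k1 by (intro incseqD[OF mono]) simp
    ultimately show ?thesis by (intro exI[of _ k2]) simp
  qed
  have "\<exists>k. n \<le> ?R k" for n
  proof (induction n)
    case (Suc n)
    then obtain j where "n \<le> ?R j" by blast
    with step[of j] show ?case by (meson Suc_le_mono order_trans)
  qed auto
  then show ?thesis
    unfolding filterlim_at_top eventually_sequentially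
    by (meson incseqD[OF mono] order_trans)
qed

text \<open>The decision to hold is made before the next price is known, so \<open>capital\<close>
  is again a supermartingale. It is nonnegative because \<open>X\<close> and \<open>a\<close> are,
  and infinitely many crossings would drive it to infinity.\<close>

lemma (in iid_selection) supermartingale_no_oscillation:
  assumes X: "supermartingale X" and nonneg: "\<And>s. 0 \<le> X s" and ab: "0 \<le> a" "a < b"
  shows "AE \<omega> in M. \<not> ((\<forall>j. \<exists>k>j. X (history k \<omega>) \<le> a) \<and> (\<forall>j. \<exists>k>j. b \<le> X (history k \<omega>)))"
proof -
  have sup: "supermartingale (capital a b X)"
    unfolding supermartingale_def
  proof
    fix s
    have "(\<Sum>n\<in>UNIV. p n * c) = c" for c
      by (simp add: p_sum flip: sum_distrib_right)
    then have "(\<Sum>n\<in>UNIV. p n * capital a b X (n # s)) =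
      capital a b X s + (if holding a b X s then (\<Sum>n\<in>UNIV. p n * X (n # s)) - X s else 0)"
      by (simp add: distrib_left right_diff_distrib sum.distrib sum_subtractf)
    also have "\<dots> \<le> capital a b X s"
      using X by (auto simp: supermartingale_def)
    finally show "(\<Sum>n\<in>UNIV. p n * capital a b X (n # s)) \<le> capital a b X s" .
  qed
  have ge: "(b - a) * rounds a b X s \<le> capital a b X s" for s
    using capital_ge[OF ab(2), of X s] nonneg[of s] ab by (auto split: if_splits)
  then have "0 \<le> capital a b X s" for s
    using ab by (intro order_trans[OF _ ge]) simp
  from supermartingale_not_to_infinity[OF sup this] show ?thesis
  proof (rule eventually_mono, safe)
    fix \<omega>
    assume nlim: "\<not> filterlim (\<lambda>k. capital a b X (history k \<omega>)) at_top sequentially"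
      and low: "\<forall>j. \<exists>k>j. X (history k \<omega>) \<le> a" and high: "\<forall>j. \<exists>k>j. b \<le> X (history k \<omega>)"
    have "filterlim (\<lambda>k. rounds a b X (history k \<omega>)) at_top sequentially"
      using rounds_to_infinity[OF ab(2)] low high by blast
    then have "filterlim (\<lambda>k. (b - a) * real (rounds a b X (history k \<omega>))) at_top sequentially"
      using ab by (intro filterlim_tendsto_pos_mult_at_top[OF tendsto_const]
          filterlim_compose[OF filterlim_real_sequentially]) auto
    then have "filterlim (\<lambda>k. capital a b X (history k \<omega>)) at_top sequentially"
      by (rule filterlim_at_top_mono) (simp add: ge)
    with nlim show False ..
  qed
qed

subsection \<open>Random block updates of an averaged operator\<close>

definition block_update :: "('e ^ 'n \<Rightarrow> 'e ^ 'n) \<Rightarrow> 'n \<Rightarrow> 'e ^ 'n \<Rightarrow> 'e ^ 'n" where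
  "block_update T n z = (\<chi> m. if m = n then T z $ m else z $ m)"

primrec block_iterate :: "('e ^ 'n \<Rightarrow> 'e ^ 'n) \<Rightarrow> 'e ^ 'n \<Rightarrow> 'n list \<Rightarrow> 'e ^ 'n" where
  "block_iterate T z0 [] = z0"
| "block_iterate T z0 (n # s) = block_update T n (block_iterate T z0 s)"

lemma norm_vec_power2: "(norm z)\<^sup>2 = (\<Sum>n\<in>UNIV. (norm (z $ n))\<^sup>2)"
  by (simp add: norm_vec_def L2_set_def sum_nonneg)

text \<open>A variant of Opial's argument. \<open>W w\<close> is comparable to the squared distance
  to \<open>w\<close>; if the iterates come close to \<open>w\<close> infinitely often, the absence
  of oscillation between \<open>a\<close> and \<open>2 * a\<close> keeps them close from some time
  on. Approximating a cluster point by such \<open>w\<close> traps the whole sequence.\<close>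

lemma converges_if_no_oscillation:
  fixes Z :: "nat \<Rightarrow> 'b::euclidean_space" and W :: "'b \<Rightarrow> 'b \<Rightarrow> real"
  assumes m: "0 < m" and lower: "\<And>w z. m * (norm (z - w))\<^sup>2 \<le> W w z"
    and K: "0 < K" and upper: "\<And>w z. W w z \<le> K * (norm (z - w))\<^sup>2"
    and T: "continuous_on UNIV T" and dense: "{z. T z = z} \<subseteq> closure S" "w0 \<in> S"
    and osc: "\<And>w a. w \<in> S \<Longrightarrow> a \<in> \<rat> \<Longrightarrow> 0 < a \<Longrightarrow>
      \<not> ((\<forall>j. \<exists>k>j. W w (Z k) \<le> a) \<and> (\<forall>j. \<exists>k>j. 2 * a \<le> W w (Z k)))"
    and freq: "\<And>j. \<exists>k>j. W w0 (Z k) \<le> B"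
    and resid: "(\<lambda>k. T (Z k) - Z k) \<longlonglongrightarrow> 0"
  shows "\<exists>z. T z = z \<and> Z \<longlonglongrightarrow> z"
proof -
  have eventually_below: "\<exists>j. \<forall>k>j. W w (Z k) < 2 * a"
    if "w \<in> S" "a \<in> \<rat>" "0 < a" "\<And>j. \<exists>k>j. W w (Z k) \<le> a" for w a
    using osc[OF that(1-3)] that(4) by (auto simp: not_le)
  have "bounded (range Z)"
  proof -
    \<comment> \<open>The level has to be rational and positive to fit \<open>osc\<close>, whatever
      the sign of \<open>B\<close>.\<close>
    obtain a where a: "a \<in> \<rat>" "max B 0 < a" "a < max B 0 + 1"
      using Rats_dense_in_real[of "max B 0" "max B 0 + 1"] by auto
    have "\<exists>k>j. W w0 (Z k) \<le> a" for j
      using freq[of j] a by (meson less_imp_le max.strict_boundedE order_trans)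
    with eventually_below[OF dense(2) a(1)] a obtain j where j: "\<And>k. k > j \<Longrightarrow> W w0 (Z k) < 2 * a"
      by auto
    have "norm (Z k) \<le> norm w0 + sqrt (2 * a / m)" if "k > j" for k
    proof -
      have "m * (norm (Z k - w0))\<^sup>2 \<le> 2 * a" using lower[where w = w0] j[OF that] by (meson less_imp_le order_trans)
      then have "(norm (Z k - w0))\<^sup>2 \<le> 2 * a / m" using m by (simp add: field_simps)
      then have "norm (Z k - w0) \<le> sqrt (2 * a / m)" by (rule real_le_rsqrt)
      then show ?thesis using norm_triangle_ineq2[of "Z k" w0] by simp
    qed
    then have "eventually (\<lambda>k. norm (Z k) \<le> norm w0 + sqrt (2 * a / m)) sequentially"
      by (auto simp: eventually_at_top_dense)
    then have "Bfun Z sequentially" by (rule BfunI)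
    then show ?thesis by (simp add: Bseq_eq_bounded)
  qed
  then obtain l r where r: "strict_mono r" and l: "(Z \<circ> r) \<longlonglongrightarrow> l"
    using bounded_imp_convergent_subsequence by blast
  have "(\<lambda>k. T ((Z \<circ> r) k)) \<longlonglongrightarrow> T l"
    by (rule continuous_on_tendsto_compose[OF T l]) auto
  then have "(\<lambda>k. T ((Z \<circ> r) k) - (Z \<circ> r) k) \<longlonglongrightarrow> T l - l"
    using l by (rule tendsto_diff)
  moreover have "(\<lambda>k. T ((Z \<circ> r) k) - (Z \<circ> r) k) \<longlonglongrightarrow> 0"
    using LIMSEQ_subseq_LIMSEQ[OF resid r] by (simp add: o_def)
  ultimately have fixed: "T l = l" using LIMSEQ_unique by fastforce
  have "Z \<longlonglongrightarrow> l"
  proof (rule metric_LIMSEQ_I)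
    fix \<epsilon> :: real assume \<epsilon>: "0 < \<epsilon>"
    \<comment> \<open>The bound on \<open>a\<close> makes \<open>W w (Z k) < 2 * a\<close> force a
      distance below \<open>\<epsilon> / 2\<close> to \<open>w\<close>. The two parts of
      \<open>\<delta>\<close> place \<open>w\<close> within \<open>\<epsilon> / 2\<close> of
      \<open>l\<close> and put every point within \<open>2 * \<delta>\<close> of \<open>w\<close> at
      level \<open>a\<close> or below.\<close>
    obtain a where a: "a \<in> \<rat>" "0 < a" "a < m * (\<epsilon> / 2)\<^sup>2 / 2"
      using Rats_dense_in_real[of 0 "m * (\<epsilon> / 2)\<^sup>2 / 2"] m \<epsilon> by auto
    define \<delta> where "\<delta> = min (\<epsilon> / 2) (sqrt (a / K) / 2)"
    have \<delta>: "0 < \<delta>" using a K \<epsilon> by (simp add: \<delta>_def)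
    have "l \<in> closure S" using dense fixed by auto
    then obtain w where w: "w \<in> S" "dist w l < \<delta>"
      using \<delta> by (auto simp: closure_approachable)
    have freq_w: "\<exists>k>j. W w (Z k) \<le> a" for j
    proof -
      have "eventually (\<lambda>k. dist ((Z \<circ> r) k) l < \<delta>) sequentially"
        using l \<delta> by (rule tendstoD)
      then obtain i where i: "\<And>k. k \<ge> i \<Longrightarrow> dist (Z (r k)) l < \<delta>"
        by (auto simp: eventually_sequentially)
      define k where "k = max i (Suc j)"
      have "dist (Z (r k)) w < 2 * \<delta>"
        using i[of k] w(2) dist_triangle2[of "Z (r k)" w l] by (simp add: k_def)
      then have "norm (Z (r k) - w) \<le> sqrt (a / K)"
        by (simp add: \<delta>_def dist_norm min_def split: if_splits)
      then have "(norm (Z (r k) - w))\<^sup>2 \<le> a / K"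
        using a K by (metis norm_ge_zero power_mono real_sqrt_pow2 divide_nonneg_pos less_imp_le)
      then have "K * (norm (Z (r k) - w))\<^sup>2 \<le> a" using K by (simp add: field_simps)
      then have "W w (Z (r k)) \<le> a" using upper order_trans by blast
      moreover have "r k > j" using seq_suble[OF r, of k] by (simp add: k_def)
      ultimately show ?thesis by blast
    qed
    from eventually_below[OF w(1) a(1,2) freq_w]
    obtain j where j: "\<And>k. k > j \<Longrightarrow> W w (Z k) < 2 * a" by blast
    have "dist (Z k) l < \<epsilon>" if "k > j" for k
    proof -
      have "m * (norm (Z k - w))\<^sup>2 < m * (\<epsilon> / 2)\<^sup>2"
        using lower[of "Z k" w] j[OF that] a(3) by linarith
      then have "(norm (Z k - w))\<^sup>2 < (\<epsilon> / 2)\<^sup>2" using m by simp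
      then have "norm (Z k - w) < \<epsilon> / 2" using \<epsilon> by (elim power_less_imp_less_base) simp
      then show ?thesis
        using w(2) dist_triangle[of "Z k" l w] by (simp add: \<delta>_def dist_norm)
    qed
    then show "\<exists>no. \<forall>k\<ge>no. dist (Z k) l < \<epsilon>" by (meson Suc_le_eq)
  qed
  with fixed show ?thesis by blast
qed

text \<open>The newest index does not enter the added term, so the sum is known before that index is
  drawn, like the compensator in a Doob decomposition.\<close>

primrec path_sum :: "('n list \<Rightarrow> real) \<Rightarrow> 'n list \<Rightarrow> real" where
  "path_sum D [] = 0"
| "path_sum D (n # s) = path_sum D s + D s"

lemma path_sum_hist: "path_sum D (hist \<sigma> k) = (\<Sum>i<k. D (hist \<sigma> i))"
  by (induction k) auto

theorem (in iid_selection) block_iterate_converges: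
  fixes T :: "'e::euclidean_space ^ 'n \<Rightarrow> 'e ^ 'n" and Q :: "'e \<Rightarrow> real"
  assumes p_pos: "\<And>n. 0 < p n"
    and T: "continuous_on UNIV T" and ex_fixed: "T w = w"
    and m: "0 < m" and lower: "\<And>e. m * (norm e)\<^sup>2 \<le> Q e"
    and upper: "\<And>e. Q e \<le> K * (norm e)\<^sup>2"
    and c: "0 < c" and decrease: "\<And>z w. T w = w \<Longrightarrow>
      (\<Sum>n\<in>UNIV. Q (T z $ n - w $ n)) + c * (norm (T z - z))\<^sup>2 \<le> (\<Sum>n\<in>UNIV. Q (z $ n - w $ n))"
  shows "AE \<omega> in M. \<exists>z. T z = z \<and> (\<lambda>k. block_iterate T z0 (history k \<omega>)) \<longlonglongrightarrow> z"
proof -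
  define W where "W w z = (\<Sum>n\<in>UNIV. Q (z $ n - w $ n) / p n)" for w z
  define Z where "Z = block_iterate T z0"
  define R where "R = path_sum (\<lambda>s. c * (norm (T (Z s) - Z s))\<^sup>2)"
  \<comment> \<open>The absolute value and the added 1 make the constant positive for every real
    \<open>K\<close>.\<close>
  define K' where "K' = (\<Sum>n\<in>UNIV. \<bar>K\<bar> / p n) + 1"
  have p_le: "p n \<le> 1" for n
    using member_le_sum[of n UNIV p] p_nonneg by (simp add: p_sum)
  have Q_nonneg: "0 \<le> Q e" for e
    by (rule order_trans[OF _ lower]) (use m in simp)
  have W_lower: "m * (norm (z - w))\<^sup>2 \<le> W w z" for w z
  proof -
    have "m * (norm (z - w))\<^sup>2 = (\<Sum>n\<in>UNIV. m * (norm (z $ n - w $ n))\<^sup>2)"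
      by (simp add: norm_vec_power2 sum_distrib_left)
    also have "\<dots> \<le> W w z" unfolding W_def
    proof (rule sum_mono)
      fix n
      have "m * (norm (z $ n - w $ n))\<^sup>2 \<le> Q (z $ n - w $ n)" by (rule lower)
      also have "\<dots> \<le> Q (z $ n - w $ n) / p n"
        using Q_nonneg p_pos p_le by (simp add: pos_le_divide_eq mult_left_le)
      finally show "m * (norm (z $ n - w $ n))\<^sup>2 \<le> Q (z $ n - w $ n) / p n" .
    qed
    finally show ?thesis .
  qed
  have W_nonneg: "0 \<le> W w z" for w z
    by (rule order_trans[OF _ W_lower]) (use m in simp)
  have K': "0 < K'"
    unfolding K'_def using p_nonneg by (intro add_nonneg_pos sum_nonneg) auto
  have W_upper: "W w z \<le> K' * (norm (z - w))\<^sup>2" for w z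
  proof -
    have "W w z \<le> (\<Sum>n\<in>UNIV. \<bar>K\<bar> / p n * (norm (z - w))\<^sup>2)"
      unfolding W_def
    proof (rule sum_mono)
      fix n
      have "Q (z $ n - w $ n) \<le> \<bar>K\<bar> * (norm (z $ n - w $ n))\<^sup>2"
        by (rule order_trans[OF upper]) (simp add: mult_right_mono)
      also have "\<dots> \<le> \<bar>K\<bar> * (norm (z - w))\<^sup>2"
        using Finite_Cartesian_Product.norm_nth_le[of "z - w" n]
        by (intro mult_left_mono power_mono) auto
      finally show "Q (z $ n - w $ n) / p n \<le> \<bar>K\<bar> / p n * (norm (z - w))\<^sup>2"
        using p_pos[of n] by (simp add: divide_right_mono)
    qed
    also have "\<dots> \<le> K' * (norm (z - w))\<^sup>2"
      by (simp add: K'_def distrib_right sum_distrib_right)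
    finally show ?thesis .
  qed
  \<comment> \<open>Block \<open>n\<close> is drawn with probability \<open>p n\<close>, which
    cancels the weight of the only block that changes. Summing over \<open>n\<close> leaves the
    decrease of the full operator step.\<close>
  have expect: "(\<Sum>n\<in>UNIV. p n * W w (block_update T n z)) + c * (norm (T z - z))\<^sup>2 \<le> W w z"
    if "T w = w" for w z
  proof -
    have "p n * W w (block_update T n z) =
        p n * W w z + (Q (T z $ n - w $ n) - Q (z $ n - w $ n))" for n
    proof -
      have "W w (block_update T n z) = Q (T z $ n - w $ n) / p n
          + (\<Sum>j\<in>UNIV - {n}. Q (z $ j - w $ j) / p j)"
        unfolding W_def by (subst sum.remove[of _ n]) (auto simp: block_update_def intro!: sum.cong)
      moreover have "W w z = Q (z $ n - w $ n) / p n
          + (\<Sum>j\<in>UNIV - {n}. Q (z $ j - w $ j) / p j)"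
        unfolding W_def by (rule sum.remove) auto
      ultimately show ?thesis using p_pos[of n] by (simp add: field_simps)
    qed
    then have "(\<Sum>n\<in>UNIV. p n * W w (block_update T n z)) =
        (\<Sum>n\<in>UNIV. p n) * W w z + ((\<Sum>n\<in>UNIV. Q (T z $ n - w $ n)) - (\<Sum>n\<in>UNIV. Q (z $ n - w $ n)))"
      by (simp add: sum.distrib sum_subtractf sum_distrib_right)
    with decrease[OF that, of z] show ?thesis by (simp add: p_sum)
  qed
  have super: "supermartingale (\<lambda>s. W w (Z s))" if "T w = w" for w
    unfolding supermartingale_def
  proof
    fix s
    have "0 \<le> c * (norm (T (Z s) - Z s))\<^sup>2" using c by simp
    with expect[OF that, of "Z s"]
    show "(\<Sum>n\<in>UNIV. p n * W w (Z (n # s))) \<le> W w (Z s)" by (simp add: Z_def)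
  qed
  have R_nonneg: "0 \<le> R s" for s
    unfolding R_def by (induction s) (use c in auto)
  have super_R: "supermartingale (\<lambda>s. W w (Z s) + R s)" if "T w = w" for w
    unfolding supermartingale_def
  proof
    fix s
    have "(\<Sum>n\<in>UNIV. p n * (W w (Z (n # s)) + R (n # s))) =
      (\<Sum>n\<in>UNIV. p n * W w (Z (n # s))) + (\<Sum>n\<in>UNIV. p n) * (R s + c * (norm (T (Z s) - Z s))\<^sup>2)"
      by (simp add: R_def distrib_left sum.distrib flip: sum_distrib_right)
    with expect[OF that, of "Z s"]
    show "(\<Sum>n\<in>UNIV. p n * (W w (Z (n # s)) + R (n # s))) \<le> W w (Z s) + R s"
      by (simp add: Z_def p_sum)
  qed
  obtain S where S: "countable S" "S \<subseteq> {z. T z = z}" "{z. T z = z} \<subseteq> closure S"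
    using separable by blast
  with ex_fixed obtain w0 where w0: "w0 \<in> S" by fastforce
  then have "T w0 = w0" using S by auto
  have "AE \<omega> in M. \<forall>w\<in>S. \<forall>a\<in>\<rat> \<inter> {0<..}.
      \<not> ((\<forall>j. \<exists>k>j. W w (Z (history k \<omega>)) \<le> a) \<and> (\<forall>j. \<exists>k>j. 2 * a \<le> W w (Z (history k \<omega>))))"
  proof (intro AE_ball_countable')
    fix w a assume "w \<in> S" "a \<in> \<rat> \<inter> {0::real<..}"
    then show "AE \<omega> in M.
      \<not> ((\<forall>j. \<exists>k>j. W w (Z (history k \<omega>)) \<le> a) \<and> (\<forall>j. \<exists>k>j. 2 * a \<le> W w (Z (history k \<omega>))))"
      using S by (intro supermartingale_no_oscillation super W_nonneg) auto
  qed (auto simp: S countable_rat)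
  moreover have "AE \<omega> in M. \<not> filterlim (\<lambda>k. W w0 (Z (history k \<omega>)) + R (history k \<omega>)) at_top sequentially"
    by (intro supermartingale_not_to_infinity super_R \<open>T w0 = w0\<close> add_nonneg_nonneg W_nonneg R_nonneg)
  ultimately show ?thesis
  proof eventually_elim
    case (elim \<omega>)
    let ?Z = "\<lambda>k. Z (history k \<omega>)"
    \<comment> \<open>One level \<open>B\<close> that is met or undercut infinitely often. The
      residual sums increase with time, so \<open>B\<close> bounds all of them; it also serves as
      the level for \<open>W w0\<close>.\<close>
    obtain B where B: "\<And>j. \<exists>k>j. W w0 (?Z k) + R (history k \<omega>) \<le> B"
      using elim(2) unfolding filterlim_at_top_dense eventually_at_top_dense
      by (meson not_less)
    have sums: "(\<Sum>i<k. c * (norm (T (?Z i) - ?Z i))\<^sup>2) \<le> B" for k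
    proof -
      obtain j where j: "j > k" "W w0 (?Z j) + R (history j \<omega>) \<le> B" using B by blast
      have "(\<Sum>i<k. c * (norm (T (?Z i) - ?Z i))\<^sup>2) \<le> (\<Sum>i<j. c * (norm (T (?Z i) - ?Z i))\<^sup>2)"
        using j c by (intro sum_mono2) auto
      also have "\<dots> = R (history j \<omega>)" by (simp add: R_def path_sum_hist)
      finally show ?thesis using j W_nonneg[of w0 "?Z j"] by linarith
    qed
    then have "summable (\<lambda>i. c * (norm (T (?Z i) - ?Z i))\<^sup>2)"
      using c sums[of "Suc k" for k] by (intro bounded_imp_summable[where B = B]) (simp_all only: lessThan_Suc_atMost, simp)
    then have "(\<lambda>i. inverse c * (c * (norm (T (?Z i) - ?Z i))\<^sup>2)) \<longlonglongrightarrow> inverse c * 0"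
      by (intro tendsto_intros summable_LIMSEQ_zero)
    then have "(\<lambda>i. (norm (T (?Z i) - ?Z i))\<^sup>2) \<longlonglongrightarrow> 0"
      using c by simp
    then have "(\<lambda>i. sqrt ((norm (T (?Z i) - ?Z i))\<^sup>2)) \<longlonglongrightarrow> sqrt 0"
      by (rule tendsto_real_sqrt)
    then have resid: "(\<lambda>i. T (?Z i) - ?Z i) \<longlonglongrightarrow> 0"
      by (simp add: tendsto_norm_zero_iff)
    have "\<exists>k>j. W w0 (?Z k) \<le> B" for j
    proof -
      obtain k where "k > j" "W w0 (?Z k) + R (history k \<omega>) \<le> B" using B by blast
      then show ?thesis using R_nonneg[of "history k \<omega>"] by (intro exI[of _ k]) simp
    qed
    from converges_if_no_oscillation[OF m W_lower K' W_upper T S(3) w0 _ this resid] elim(1)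
    show ?case by (simp add: Z_def)
  qed
qed

subsection \<open>Cocoercivity of the gradient\<close>

text \<open>Expanding the derivative in the standard basis gives a representing vector; uniqueness
  of the derivative makes the definite description in \<open>grad\<close> denote it.\<close>

lemma GDERIV_grad:
  assumes "f differentiable_on UNIV"
  shows "GDERIV f x :> grad f x"
proof -
  obtain f' where f': "(f has_derivative f') (at x)"
    using assms by (auto simp: differentiable_on_def differentiable_def)
  interpret linear f' using f' by (rule has_derivative_linear)
  have "f' h = h \<bullet> (\<Sum>b\<in>Basis. f' b *\<^sub>R b)" for h
  proof -
    have "f' h = f' (\<Sum>b\<in>Basis. (h \<bullet> b) *\<^sub>R b)" by (simp add: euclidean_representation)
    also have "\<dots> = (\<Sum>b\<in>Basis. (h \<bullet> b) * f' b)" by (simp add: sum scale)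
    also have "\<dots> = h \<bullet> (\<Sum>b\<in>Basis. f' b *\<^sub>R b)" by (simp add: inner_sum_right mult.commute)
    finally show ?thesis .
  qed
  then have "f' = (\<lambda>h. h \<bullet> (\<Sum>b\<in>Basis. f' b *\<^sub>R b))" by (rule ext)
  then have "GDERIV f x :> (\<Sum>b\<in>Basis. f' b *\<^sub>R b)"
    using f' unfolding gderiv_def by metis
  then show ?thesis
    unfolding grad_def
  proof (rule theI)
    fix d assume "GDERIV f x :> d"
    then have "(\<lambda>h. h \<bullet> d) = (\<lambda>h. h \<bullet> (\<Sum>b\<in>Basis. f' b *\<^sub>R b))"
      using \<open>GDERIV f x :> (\<Sum>b\<in>Basis. f' b *\<^sub>R b)\<close> unfolding gderiv_def
      by (rule has_derivative_unique)
    then show "d = (\<Sum>b\<in>Basis. f' b *\<^sub>R b)"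
      by (metis inner_commute vector_eq_ldot)
  qed
qed

lemma DERIV_along_line:
  assumes "\<And>x. GDERIV f x :> grad f x"
  shows "((\<lambda>t. f (x + t *\<^sub>R d)) has_real_derivative (d \<bullet> grad f (x + t *\<^sub>R d))) (at t)"
proof -
  have "((\<lambda>t. x + t *\<^sub>R d) has_derivative (\<lambda>s. s *\<^sub>R d)) (at t)"
    by (auto intro!: derivative_eq_intros)
  from has_derivative_compose[OF this assms[unfolded gderiv_def]]
  show ?thesis by (simp add: has_field_derivative_def mult.commute[of _ "d \<bullet> _"] mult_commute_abs)
qed

lemma convex_gradient_inequality:
  fixes f :: "'a::euclidean_space \<Rightarrow> real"
  assumes f: "convex_on UNIV f" "\<And>x. GDERIV f x :> grad f x"
  shows "f x + grad f x \<bullet> (y - x) \<le> f y"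
proof -
  define h where "h t = f (x + t *\<^sub>R (y - x))" for t
  have "convex_on UNIV h"
  proof (rule convex_onI)
    fix t a b :: real assume t: "0 < t" "t < 1"
    have "x + ((1 - t) * a + t * b) *\<^sub>R (y - x) =
      (1 - t) *\<^sub>R (x + a *\<^sub>R (y - x)) + t *\<^sub>R (x + b *\<^sub>R (y - x))"
      by (simp add: algebra_simps)
    then show "h ((1 - t) *\<^sub>R a + t *\<^sub>R b) \<le> (1 - t) * h a + t * h b"
      using convex_onD[OF f(1), of t "x + a *\<^sub>R (y - x)" "x + b *\<^sub>R (y - x)"] t
      by (simp add: h_def)
  qed simp
  moreover have "(h has_real_derivative ((y - x) \<bullet> grad f x)) (at 0)"
    using DERIV_along_line[OF f(2), of x "y - x" 0] by (simp add: h_def[abs_def])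
  ultimately have "((y - x) \<bullet> grad f x) * (1 - 0) \<le> h 1 - h 0"
    by (intro convex_on_imp_above_tangent[where A = UNIV]) auto
  then show ?thesis by (simp add: h_def inner_commute)
qed

lemma descent_lemma:
  fixes f :: "'a::euclidean_space \<Rightarrow> real"
  assumes f: "\<And>x. GDERIV f x :> grad f x" and L: "L-lipschitz_on UNIV (grad f)"
  shows "f (x + d) \<le> f x + grad f x \<bullet> d + L / 2 * (norm d)\<^sup>2"
proof -
  define h where "h t = f (x + t *\<^sub>R d) - t * (grad f x \<bullet> d) - L / 2 * t\<^sup>2 * (norm d)\<^sup>2" for t
  have "h 1 \<le> h 0"
  proof (rule DERIV_nonpos_imp_nonincreasing[of 0 1])
    fix t :: real assume t: "0 \<le> t" "t \<le> 1"
    let ?D = "d \<bullet> grad f (x + t *\<^sub>R d) - grad f x \<bullet> d - L * t * (norm d)\<^sup>2"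
    have "(h has_real_derivative ?D) (at t)"
      unfolding h_def by (auto intro!: derivative_eq_intros DERIV_along_line f)
    moreover have "?D \<le> 0"
    proof -
      have "d \<bullet> (grad f (x + t *\<^sub>R d) - grad f x) \<le> norm d * norm (grad f (x + t *\<^sub>R d) - grad f x)"
        by (rule norm_cauchy_schwarz)
      also have "\<dots> \<le> norm d * (L * norm (t *\<^sub>R d))"
        using lipschitz_onD[OF L, of "x + t *\<^sub>R d" x] by (intro mult_left_mono) (auto simp: dist_norm)
      also have "\<dots> = L * t * (norm d)\<^sup>2" using t by (simp add: power2_eq_square)
      finally show ?thesis by (simp add: inner_diff_right inner_commute)
    qed
    ultimately show "\<exists>y. (h has_real_derivative y) (at t) \<and> y \<le> 0" by blast
  qed simp
  then show ?thesis by (simp add: h_def)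
qed

text \<open>The Baillon-Haddad theorem: \<open>half\<close> is added to itself with \<open>x\<close>
  and \<open>y\<close> exchanged.\<close>

lemma gradient_cocoercive:
  fixes f :: "'a::euclidean_space \<Rightarrow> real"
  assumes f: "convex_on UNIV f" "\<And>x. GDERIV f x :> grad f x"
    and \<beta>: "0 < \<beta>" and L: "(1 / \<beta>)-lipschitz_on UNIV (grad f)"
  shows "\<beta> * (norm (grad f x - grad f y))\<^sup>2 \<le> (grad f x - grad f y) \<bullet> (x - y)"
proof -
  have half: "\<beta> / 2 * (norm (grad f y - grad f x))\<^sup>2 \<le> f y - f x - grad f x \<bullet> (y - x)" for x y
  proof -
    let ?d = "grad f y - grad f x"
    \<comment> \<open>At this trial point the tangent bound from \<open>x\<close> meets the
      quadratic bound from \<open>y\<close>. Step length \<open>t\<close> yields the factor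
      \<open>t - t^2 / (2 * \<beta>)\<close>, which is largest at
      \<open>t = \<beta>\<close>.\<close>
    let ?u = "y + (- \<beta>) *\<^sub>R ?d"
    have "f x + grad f x \<bullet> (?u - x) \<le> f ?u"
      by (rule convex_gradient_inequality[OF f])
    also have "\<dots> \<le> f y + grad f y \<bullet> ((- \<beta>) *\<^sub>R ?d) + 1 / \<beta> / 2 * (norm ((- \<beta>) *\<^sub>R ?d))\<^sup>2"
      by (rule descent_lemma[OF f(2) L])
    also have "1 / \<beta> / 2 * (norm ((- \<beta>) *\<^sub>R ?d))\<^sup>2 = \<beta> / 2 * (norm ?d)\<^sup>2"
      using \<beta> by (simp add: power2_eq_square)
    finally have "\<beta> * (?d \<bullet> ?d) \<le> f y - f x - grad f x \<bullet> (y - x) + \<beta> / 2 * (norm ?d)\<^sup>2"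
      by (simp add: inner_diff_left inner_diff_right inner_add_right inner_commute algebra_simps)
    then show ?thesis by (simp add: power2_norm_eq_inner)
  qed
  show ?thesis
    using half[where x = x and y = y] half[where x = y and y = x]
    by (simp add: norm_minus_commute[of "grad f x"] inner_diff_left inner_diff_right inner_commute algebra_simps)
qed

text \<open>The surplus with factor \<open>2 * \<beta> - \<gamma>\<close> is kept because it later
  pays for the part of the movement of \<open>x\<close> that is caused by the gradient.\<close>

lemma forward_step_bound:
  fixes f :: "'a::euclidean_space \<Rightarrow> real"
  assumes f: "convex_on UNIV f" "\<And>x. GDERIV f x :> grad f x"
    and \<beta>: "0 < \<beta>" and L: "(1 / \<beta>)-lipschitz_on UNIV (grad f)" and \<gamma>: "0 < \<gamma>"
  shows "(norm ((x - \<gamma> *\<^sub>R grad f x) - (y - \<gamma> *\<^sub>R grad f y)))\<^sup>2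
    \<le> (norm (x - y))\<^sup>2 - \<gamma> * (2 * \<beta> - \<gamma>) * (norm (grad f x - grad f y))\<^sup>2"
proof -
  let ?d = "grad f x - grad f y"
  have "(norm ((x - \<gamma> *\<^sub>R grad f x) - (y - \<gamma> *\<^sub>R grad f y)))\<^sup>2 = (norm ((x - y) - \<gamma> *\<^sub>R ?d))\<^sup>2"
    by (simp add: algebra_simps)
  also have "\<dots> = (norm (x - y))\<^sup>2 - 2 * \<gamma> * (?d \<bullet> (x - y)) + \<gamma>\<^sup>2 * (norm ?d)\<^sup>2"
    unfolding power2_norm_eq_inner inner_diff_left[of "x - y"] inner_diff_right[of _ "x - y"]
    by (simp add: inner_commute power2_eq_square)
  also have "\<dots> \<le> (norm (x - y))\<^sup>2 - 2 * \<gamma> * (\<beta> * (norm ?d)\<^sup>2) + \<gamma>\<^sup>2 * (norm ?d)\<^sup>2"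
    using gradient_cocoercive[OF f \<beta> L, of x y] \<gamma> by simp
  finally show ?thesis by (simp add: algebra_simps power2_eq_square)
qed

subsection \<open>Proximity operators\<close>

lemma Gamma0_not_MInf: "\<phi> \<in> Gamma0 \<Longrightarrow> \<phi> x \<noteq> -\<infinity>"
  by (simp add: Gamma0_def proper_fun_def)

lemma Gamma0_eff_dom: "\<phi> \<in> Gamma0 \<Longrightarrow> x \<in> eff_dom \<phi> \<Longrightarrow> \<phi> x = ereal (real_of_ereal (\<phi> x))"
  using Gamma0_not_MInf[of \<phi> x] by (cases "\<phi> x") (auto simp: eff_dom_def)

lemma not_eff_dom: "x \<notin> eff_dom \<phi> \<Longrightarrow> \<phi> x = \<infinity>"
  by (simp add: eff_dom_def)

lemma Gamma0_convex_on:
  assumes \<phi>: "\<phi> \<in> Gamma0"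
  shows "convex_on (eff_dom \<phi>) (\<lambda>x. real_of_ereal (\<phi> x))"
proof -
  have le: "\<phi> ((1 - t) *\<^sub>R x + t *\<^sub>R y) \<le>
      ereal ((1 - t) * real_of_ereal (\<phi> x) + t * real_of_ereal (\<phi> y))"
    if "x \<in> eff_dom \<phi>" "y \<in> eff_dom \<phi>" "0 \<le> t" "t \<le> 1" for x y t
  proof -
    have "\<phi> ((1 - t) *\<^sub>R x + t *\<^sub>R y) \<le> ereal (1 - t) * \<phi> x + ereal t * \<phi> y"
      using \<phi> that by (auto simp: Gamma0_def convex_fun_def)
    then show ?thesis
      by (subst (asm) Gamma0_eff_dom[OF \<phi> that(1)], subst (asm) Gamma0_eff_dom[OF \<phi> that(2)]) simp
  qed
  have conv: "convex (eff_dom \<phi>)"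
    unfolding convex_alt
  proof safe
    fix x y and t :: real
    assume "x \<in> eff_dom \<phi>" "y \<in> eff_dom \<phi>" "0 \<le> t" "t \<le> 1"
    from le[OF this] have "\<phi> ((1 - t) *\<^sub>R x + t *\<^sub>R y) < \<infinity>" by (rule order.strict_trans1) simp
    then show "(1 - t) *\<^sub>R x + t *\<^sub>R y \<in> eff_dom \<phi>" by (simp add: eff_dom_def)
  qed
  then show ?thesis
  proof (rule convex_onI[rotated])
    fix t :: real and x y
    assume t: "0 < t" "t < 1" and xy: "x \<in> eff_dom \<phi>" "y \<in> eff_dom \<phi>"
    have "(1 - t) *\<^sub>R x + t *\<^sub>R y \<in> eff_dom \<phi>"
      using conv xy t by (intro convexD_alt) auto
    from Gamma0_eff_dom[OF \<phi> this] le[OF xy, of t] t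
    show "real_of_ereal (\<phi> ((1 - t) *\<^sub>R x + t *\<^sub>R y)) \<le>
        (1 - t) * real_of_ereal (\<phi> x) + t * real_of_ereal (\<phi> y)"
      by (metis ereal_less_eq(3) less_imp_le)
  qed
qed

text \<open>The lower limit is over punctured neighbourhoods; the assumption at \<open>x\<close>
  itself fills the hole.\<close>

lemma Gamma0_eventually_greater:
  assumes "\<phi> \<in> Gamma0" "ereal s < \<phi> x"
  shows "\<forall>\<^sub>F u in nhds x. ereal s < \<phi> u"
proof -
  have "\<phi> x \<le> Liminf (at x) \<phi>" using assms by (simp add: Gamma0_def lsc_fun_def)
  then have "\<forall>\<^sub>F u in at x. ereal s < \<phi> u" using assms(2) by (simp add: le_Liminf_iff)
  then show ?thesis
    using assms(2) by (auto simp: eventually_at_filter elim!: eventually_mono)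
qed

lemma Gamma0_scale:
  assumes \<phi>: "\<phi> \<in> Gamma0" and c: "0 < c"
  shows "(\<lambda>u. ereal c * \<phi> u) \<in> Gamma0"
proof -
  have MInf: "\<phi> u \<noteq> -\<infinity>" for u by (rule Gamma0_not_MInf[OF \<phi>])
  have "ereal c * \<phi> u \<noteq> -\<infinity>" for u
    using MInf[of u] c by (cases "\<phi> u") auto
  moreover have "eff_dom (\<lambda>u. ereal c * \<phi> u) = eff_dom \<phi>"
    using c by (auto simp: eff_dom_def ereal_mult_less_right ereal_mult_eq_PInfty less_top)
  moreover have "lsc_fun (\<lambda>u. ereal c * \<phi> u)"
    unfolding lsc_fun_def
  proof
    fix x
    have "ereal c * \<phi> x \<le> ereal c * Liminf (at x) \<phi>"
      using \<phi> c by (intro ereal_mult_left_mono) (auto simp: Gamma0_def lsc_fun_def)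
    also have "\<dots> = Liminf (at x) (\<lambda>u. ereal c * \<phi> u)"
      using c by (intro Liminf_ereal_mult_left[symmetric]) auto
    finally show "ereal c * \<phi> x \<le> Liminf (at x) (\<lambda>u. ereal c * \<phi> u)" .
  qed
  moreover have "convex_fun (\<lambda>u. ereal c * \<phi> u)"
    unfolding convex_fun_def
  proof (intro allI ballI)
    fix x y and t :: real assume t: "t \<in> {0..1}"
    have "ereal c * \<phi> ((1 - t) *\<^sub>R x + t *\<^sub>R y) \<le> ereal c * (ereal (1 - t) * \<phi> x + ereal t * \<phi> y)"
      using \<phi> c t by (intro ereal_mult_left_mono) (auto simp: Gamma0_def convex_fun_def)
    also have "\<dots> = ereal (1 - t) * (ereal c * \<phi> x) + ereal t * (ereal c * \<phi> y)"
    proof -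
      have "ereal r * \<phi> w \<noteq> -\<infinity>" if "0 \<le> r" for r w
        using that MInf[of w] by (cases "\<phi> w") auto
      with t have "ereal c * (ereal (1 - t) * \<phi> x + ereal t * \<phi> y)
          = ereal c * (ereal (1 - t) * \<phi> x) + ereal c * (ereal t * \<phi> y)"
        by (intro ereal_distrib_left) auto
      then show ?thesis by (simp only: mult.left_commute)
    qed
    finally show "ereal c * \<phi> ((1 - t) *\<^sub>R x + t *\<^sub>R y)
        \<le> ereal (1 - t) * (ereal c * \<phi> x) + ereal t * (ereal c * \<phi> y)" .
  qed
  ultimately show ?thesis
    using \<phi> by (simp add: Gamma0_def proper_fun_def)
qed

text \<open>Without a minimizer the sets where \<open>\<psi>\<close> exceeds
  \<open>\<psi> u\<close>, for \<open>u\<close> in \<open>K\<close>, would have interiors covering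
  \<open>K\<close>. In a finite subcover, the \<open>u\<close> of least value would be left
  uncovered.\<close>

lemma lsc_attains_minimum:
  fixes \<psi> :: "'a::topological_space \<Rightarrow> ereal"
  assumes K: "compact K" "K \<noteq> {}" and MInf: "\<And>u. \<psi> u \<noteq> -\<infinity>"
    and lsc: "\<And>s x. x \<in> K \<Longrightarrow> ereal s < \<psi> x \<Longrightarrow> \<forall>\<^sub>F u in nhds x. ereal s < \<psi> u"
  shows "\<exists>x\<in>K. \<forall>u\<in>K. \<psi> x \<le> \<psi> u"
proof (rule ccontr)
  assume "\<not> ?thesis"
  then have no_min: "\<exists>u\<in>K. \<psi> u < \<psi> x" if "x \<in> K" for x using that by (auto simp: not_le)
  have "K \<subseteq> (\<Union>u\<in>K. interior {w. \<psi> u < \<psi> w})"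
  proof
    fix x assume x: "x \<in> K"
    then obtain u where u: "u \<in> K" "\<psi> u < \<psi> x" using no_min by blast
    then obtain s where "\<psi> u = ereal s" using MInf[of u] by (cases "\<psi> u") auto
    with lsc[OF x, of s] u have "\<forall>\<^sub>F w in nhds x. \<psi> u < \<psi> w" by simp
    then have "x \<in> interior {w. \<psi> u < \<psi> w}"
      by (auto simp: eventually_nhds interior_def)
    with u show "x \<in> (\<Union>u\<in>K. interior {w. \<psi> u < \<psi> w})" by blast
  qed
  then obtain F where F: "F \<subseteq> K" "finite F" "K \<subseteq> (\<Union>u\<in>F. interior {w. \<psi> u < \<psi> w})"
    using compactE_image[OF K(1), of K "\<lambda>u. interior {w. \<psi> u < \<psi> w}"] by auto
  with K(2) have "F \<noteq> {}" by auto
  with F(2) have "Min (\<psi> ` F) \<in> \<psi> ` F" by (intro Min_in) auto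
  then obtain u0 where u0: "u0 \<in> F" "\<psi> u0 = Min (\<psi> ` F)" by auto
  then obtain u where "u \<in> F" "u0 \<in> interior {w. \<psi> u < \<psi> w}" using F by blast
  then have "\<psi> u < \<psi> u0" using interior_subset by blast
  then show False using u0(2) F(2) \<open>u \<in> F\<close> by (simp add: leD)
qed

text \<open>
  A lower bound on the unit ball around a point of the domain propagates along rays by convexity,
  with no need for an affine minorant.
\<close>

lemma Gamma0_linear_lower_bound:
  assumes \<phi>: "\<phi> \<in> Gamma0" and x0: "\<phi> x0 = ereal c0"
  shows "\<exists>C\<ge>0. \<forall>u. ereal (c0 - C - C * norm (u - x0)) \<le> \<phi> u"
proof -
  have "\<exists>a\<in>cball x0 1. \<forall>u\<in>cball x0 1. \<phi> a \<le> \<phi> u"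
    by (rule lsc_attains_minimum)
      (auto simp: Gamma0_not_MInf[OF \<phi>] intro: Gamma0_eventually_greater[OF \<phi>])
  then obtain a where a: "\<And>u. u \<in> cball x0 1 \<Longrightarrow> \<phi> a \<le> \<phi> u" by blast
  have "\<phi> a \<le> ereal c0" using a[of x0] x0 by simp
  then obtain m where m: "\<phi> a = ereal m" "m \<le> c0"
    using Gamma0_not_MInf[OF \<phi>, of a] by (cases "\<phi> a") auto
  have "ereal (m - (c0 - m) * norm (u - x0)) \<le> \<phi> u" for u
  proof (cases "u \<in> eff_dom \<phi> \<and> 1 < norm (u - x0)")
    case True
    define r where "r = norm (u - x0)"
    define t where "t = 1 / r"
    have r: "1 < r" using True by (simp add: r_def)
    then have t: "0 < t" "t < 1" by (auto simp: t_def)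
    obtain b where b: "\<phi> u = ereal b" using Gamma0_eff_dom[OF \<phi>] True by blast
    have "(1 - t) *\<^sub>R x0 + t *\<^sub>R u - x0 = t *\<^sub>R (u - x0)" by (simp add: algebra_simps)
    moreover have "norm (t *\<^sub>R (u - x0)) = 1" using r by (simp add: t_def flip: r_def)
    ultimately have "dist x0 ((1 - t) *\<^sub>R x0 + t *\<^sub>R u) = 1"
      by (metis dist_commute dist_norm)
    then have "ereal m \<le> \<phi> ((1 - t) *\<^sub>R x0 + t *\<^sub>R u)" using a m by simp
    also have "\<dots> \<le> ereal (1 - t) * \<phi> x0 + ereal t * \<phi> u"
      using \<phi> t by (auto simp: Gamma0_def convex_fun_def)
    finally have "m \<le> (1 - t) * c0 + t * b" by (simp add: x0 b)
    then have "r * m \<le> r * ((1 - t) * c0 + t * b)" using r by simp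
    also have "\<dots> = (r - 1) * c0 + b" using r by (simp add: t_def field_simps)
    finally show ?thesis using m(2) by (simp add: b r_def[symmetric] algebra_simps)
  next
    case False
    show ?thesis
    proof (cases "u \<in> eff_dom \<phi>")
      case True
      with False have "ereal m \<le> \<phi> u" using a[of u] m by (simp add: dist_norm norm_minus_commute)
      moreover have "ereal (m - (c0 - m) * norm (u - x0)) \<le> ereal m" using m by simp
      ultimately show ?thesis by (rule order_trans[rotated])
    qed (simp add: not_eff_dom)
  qed
  then show ?thesis using m by (intro exI[of _ "c0 - m"]) simp
qed

text \<open>Outside a large ball the quadratic term beats the linear lower bound on
  \<open>\<phi>\<close>, so a minimum over the ball is global. Existence then passes to the point
  that \<open>ARG_MIN\<close> chooses.\<close>

lemma prox_minimizes:
  fixes x :: "'a::euclidean_space"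
  assumes \<phi>: "\<phi> \<in> Gamma0"
  shows "\<phi> (prox \<phi> x) + ereal (1/2 * (norm (x - prox \<phi> x))\<^sup>2) \<le> \<phi> u + ereal (1/2 * (norm (x - u))\<^sup>2)"
proof -
  define q where "q u = 1/2 * (norm (x - u))\<^sup>2" for u
  define \<psi> where "\<psi> u = \<phi> u + ereal (q u)" for u
  have MInf: "\<psi> u \<noteq> -\<infinity>" for u
    using Gamma0_not_MInf[OF \<phi>, of u] by (simp add: \<psi>_def)
  have lsc: "\<forall>\<^sub>F u in nhds w. ereal s < \<psi> u" if "ereal s < \<psi> w" for s w
  proof -
    have "ereal (s - q w) < \<phi> w" using that by (cases "\<phi> w") (auto simp: \<psi>_def)
    then obtain s' where s': "s - q w < s'" "ereal s' < \<phi> w"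
      using ereal_dense2 by (metis less_ereal.simps(1))
    have "\<forall>\<^sub>F u in nhds w. ereal s' < \<phi> u" by (rule Gamma0_eventually_greater[OF \<phi> s'(2)])
    moreover have "((\<lambda>u. s - q u) \<longlongrightarrow> s - q w) (nhds w)"
      unfolding q_def by (intro tendsto_intros filterlim_ident)
    then have "\<forall>\<^sub>F u in nhds w. s - q u < s'" using s'(1) by (rule order_tendstoD)
    ultimately show ?thesis
    proof eventually_elim
      case (elim u)
      then show ?case by (cases "\<phi> u") (auto simp: \<psi>_def)
    qed
  qed
  obtain x0 c0 where x0: "\<phi> x0 = ereal c0"
    using \<phi> Gamma0_eff_dom[OF \<phi>] by (auto simp: Gamma0_def proper_fun_def)
  obtain C where C: "0 \<le> C" "\<And>u. ereal (c0 - C - C * norm (u - x0)) \<le> \<phi> u"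
    using Gamma0_linear_lower_bound[OF \<phi> x0] by blast
  define d where "d = norm (x - x0)"
  define R where "R = 2 * (C + d) + 2"
  have "0 \<le> d" by (simp add: d_def)
  have "0 \<le> R" using C \<open>0 \<le> d\<close> by (simp add: R_def)
  have outside: "\<psi> x0 \<le> \<psi> u" if "u \<notin> cball x0 R" for u
  proof -
    define r where "r = norm (u - x0)"
    have r: "R < r" using that by (simp add: r_def dist_norm norm_minus_commute)
    have "r - d \<le> norm (x - u)"
      using norm_triangle_ineq4[of "x - x0" "x - u"] by (simp add: r_def d_def norm_minus_commute algebra_simps)
    then have "(r - d)\<^sup>2 \<le> (norm (x - u))\<^sup>2"
      using r C \<open>0 \<le> d\<close> by (intro power_mono) (auto simp: R_def)
    moreover have "C \<le> r * (r / 2 - (C + d))"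
    proof -
      have "r * 1 \<le> r * (r / 2 - (C + d))"
        using r C \<open>0 \<le> d\<close> by (intro mult_left_mono) (auto simp: R_def)
      moreover have "C \<le> r" using r C \<open>0 \<le> d\<close> by (simp add: R_def)
      ultimately show ?thesis by linarith
    qed
    ultimately have "c0 + q x0 \<le> c0 - C - C * r + q u"
      by (simp add: q_def d_def[symmetric] power2_eq_square algebra_simps)
    then have "\<psi> x0 \<le> ereal (c0 - C - C * r) + ereal (q u)" by (simp add: \<psi>_def x0)
    also have "\<dots> \<le> \<psi> u" unfolding \<psi>_def using C(2)[of u] by (intro add_mono) (auto simp: r_def)
    finally show ?thesis .
  qed
  have "\<exists>z\<in>cball x0 R. \<forall>u\<in>cball x0 R. \<psi> z \<le> \<psi> u"
    by (rule lsc_attains_minimum[OF _ _ MInf]) (use \<open>0 \<le> R\<close> lsc in auto)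
  then obtain z where z: "\<And>u. u \<in> cball x0 R \<Longrightarrow> \<psi> z \<le> \<psi> u" by blast
  have "\<psi> z \<le> \<psi> u" for u
    using z[of u] z[of x0] outside[of u] \<open>0 \<le> R\<close> by (cases "u \<in> cball x0 R") auto
  then have "is_arg_min \<psi> (\<lambda>_. True) z" by (auto simp: is_arg_min_def not_less)
  then have "is_arg_min \<psi> (\<lambda>_. True) (prox \<phi> x)"
    unfolding prox_def arg_min_def \<psi>_def q_def by (rule someI)
  then show ?thesis by (auto simp: is_arg_min_def not_less \<psi>_def q_def)
qed

text \<open>For \<open>\<phi>\<close> in \<open>Gamma0\<close> the values on the effective domain
  are finite and the subgradient inequality is trivial elsewhere, so this is the usual notion,
  expressed in real arithmetic.\<close>

definition is_subgradient :: "('a::euclidean_space \<Rightarrow> ereal) \<Rightarrow> 'a \<Rightarrow> 'a \<Rightarrow> bool" where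
  "is_subgradient \<phi> x h \<longleftrightarrow> x \<in> eff_dom \<phi> \<and> (\<forall>u\<in>eff_dom \<phi>.
     real_of_ereal (\<phi> x) + h \<bullet> (u - x) \<le> real_of_ereal (\<phi> u))"

lemma subgradient_monotone:
  assumes "is_subgradient \<phi> x h" "is_subgradient \<phi> y k"
  shows "0 \<le> (h - k) \<bullet> (x - y)"
proof -
  have "real_of_ereal (\<phi> x) + h \<bullet> (y - x) \<le> real_of_ereal (\<phi> y)"
    and "real_of_ereal (\<phi> y) + k \<bullet> (x - y) \<le> real_of_ereal (\<phi> x)"
    using assms by (auto simp: is_subgradient_def)
  then show ?thesis by (simp add: inner_diff_left inner_diff_right)
qed

text \<open>Fermat's rule: a move by the fraction \<open>t\<close> from the proximal point towards
  \<open>u\<close> changes the quadratic to first order by the inner product, and the error of order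
  \<open>t^2\<close> vanishes after division by \<open>t\<close>.\<close>

lemma subgradient_prox:
  assumes \<phi>: "\<phi> \<in> Gamma0"
  shows "is_subgradient \<phi> (prox \<phi> x) (x - prox \<phi> x)"
proof -
  let ?p = "prox \<phi> x" and ?r = "\<lambda>u. real_of_ereal (\<phi> u)"
  obtain x0 where x0: "x0 \<in> eff_dom \<phi>"
    using \<phi> by (auto simp: Gamma0_def proper_fun_def)
  have "\<phi> ?p + ereal (1/2 * (norm (x - ?p))\<^sup>2) < \<infinity>"
    using prox_minimizes[OF \<phi>, of x x0] x0 by (auto simp: eff_dom_def intro: order.strict_trans1)
  then have dom: "?p \<in> eff_dom \<phi>" by (auto simp: eff_dom_def)
  have "?r ?p + (x - ?p) \<bullet> (u - ?p) \<le> ?r u" if u: "u \<in> eff_dom \<phi>" for u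
  proof -
    define b where "b = (norm (u - ?p))\<^sup>2 / 2"
    have "?r ?p + (x - ?p) \<bullet> (u - ?p) - ?r u \<le> t * b" if t: "0 < t" "t < 1" for t
    proof -
      let ?w = "(1 - t) *\<^sub>R ?p + t *\<^sub>R u"
      have w: "?w \<in> eff_dom \<phi>"
        using Gamma0_convex_on[OF \<phi>] dom u t
        by (intro convexD_alt) (auto simp: convex_on_def)
      have "?r ?p + 1/2 * (norm (x - ?p))\<^sup>2 \<le> ?r ?w + 1/2 * (norm (x - ?w))\<^sup>2"
        using prox_minimizes[OF \<phi>, of x ?w] Gamma0_eff_dom[OF \<phi> dom] Gamma0_eff_dom[OF \<phi> w]
        by (metis ereal_less_eq(3) plus_ereal.simps(1))
      also have "?r ?w \<le> (1 - t) * ?r ?p + t * ?r u"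
        using Gamma0_convex_on[OF \<phi>] dom u t by (intro convex_onD) auto
      also have "x - ?w = (x - ?p) - t *\<^sub>R (u - ?p)" by (simp add: algebra_simps)
      also have "1/2 * (norm \<dots>)\<^sup>2 = 1/2 * (norm (x - ?p))\<^sup>2 - t * ((x - ?p) \<bullet> (u - ?p)) + t * (t * b)"
        unfolding b_def power2_norm_eq_inner inner_diff_left[of "x - ?p"] inner_diff_right[of _ "x - ?p"]
          inner_scaleR_left inner_scaleR_right
        by (simp add: inner_commute[of "u - ?p" "x - ?p"] field_simps)
      finally have "t * (?r ?p + (x - ?p) \<bullet> (u - ?p) - ?r u) \<le> t * (t * b)"
        by (simp add: algebra_simps)
      then show ?thesis using t by (simp add: mult_le_cancel_left_pos)
    qed
    then have "\<forall>\<^sub>F t in at_right 0. ?r ?p + (x - ?p) \<bullet> (u - ?p) - ?r u \<le> t * b"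
      by (intro eventually_at_rightI[of 0 1]) auto
    moreover have "((\<lambda>t. t * b) \<longlongrightarrow> 0 * b) (at_right 0)" by (intro tendsto_intros)
    ultimately have "?r ?p + (x - ?p) \<bullet> (u - ?p) - ?r u \<le> 0 * b"
      by (intro tendsto_lowerbound) auto
    then show ?thesis by simp
  qed
  with dom show ?thesis by (simp add: is_subgradient_def)
qed

text \<open>\<open>x\<close> and the proximal point each add up with a subgradient to
  \<open>x + h\<close>; monotonicity allows only one such point.\<close>

lemma prox_eqI:
  assumes \<phi>: "\<phi> \<in> Gamma0" and h: "is_subgradient \<phi> x h"
  shows "prox \<phi> (x + h) = x"
proof -
  have "0 \<le> (x - prox \<phi> (x + h)) \<bullet> (prox \<phi> (x + h) - x)"
    using subgradient_monotone[OF subgradient_prox[OF \<phi>, of "x + h"] h] by simp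
  then have "(norm (prox \<phi> (x + h) - x))\<^sup>2 \<le> 0"
    by (simp add: power2_norm_eq_inner inner_diff_left inner_diff_right inner_commute)
  then show ?thesis by simp
qed

lemma prox_firmly_nonexpansive:
  assumes \<phi>: "\<phi> \<in> Gamma0"
  shows "(norm (prox \<phi> x - prox \<phi> y))\<^sup>2 \<le> (prox \<phi> x - prox \<phi> y) \<bullet> (x - y)"
proof -
  let ?d = "prox \<phi> x - prox \<phi> y"
  have "0 \<le> ((x - prox \<phi> x) - (y - prox \<phi> y)) \<bullet> ?d"
    by (rule subgradient_monotone[OF subgradient_prox[OF \<phi>] subgradient_prox[OF \<phi>]])
  also have "((x - prox \<phi> x) - (y - prox \<phi> y)) = (x - y) - ?d" by simp
  finally show ?thesis
    by (simp add: power2_norm_eq_inner inner_diff_left[of "x - y"] inner_commute[of "x - y"])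
qed

lemma prox_residual_firmly_nonexpansive:
  assumes \<phi>: "\<phi> \<in> Gamma0"
  shows "(norm ((x - prox \<phi> x) - (y - prox \<phi> y)))\<^sup>2 \<le> ((x - prox \<phi> x) - (y - prox \<phi> y)) \<bullet> (x - y)"
proof -
  let ?d = "prox \<phi> x - prox \<phi> y"
  have eq: "(x - prox \<phi> x) - (y - prox \<phi> y) = (x - y) - ?d" by simp
  show ?thesis
    unfolding eq using prox_firmly_nonexpansive[OF \<phi>, of x y]
    by (simp only: power2_norm_eq_inner inner_diff_left[of "x - y"] inner_diff_right[of _ "x - y"])
      (simp add: inner_commute)
qed

lemma continuous_on_prox:
  assumes \<phi>: "\<phi> \<in> Gamma0"
  shows "continuous_on UNIV (prox \<phi>)"
proof -
  have "norm (prox \<phi> x - prox \<phi> y) \<le> norm (x - y)" for x y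
  proof (cases "prox \<phi> x = prox \<phi> y")
    case False
    have "norm (prox \<phi> x - prox \<phi> y) * norm (prox \<phi> x - prox \<phi> y)
      \<le> norm (prox \<phi> x - prox \<phi> y) * norm (x - y)"
      using prox_firmly_nonexpansive[OF \<phi>, of x y] norm_cauchy_schwarz[of "prox \<phi> x - prox \<phi> y" "x - y"]
      by (simp add: power2_eq_square)
    with False show ?thesis by simp
  qed simp
  then have "1-lipschitz_on UNIV (prox \<phi>)" by (auto intro!: lipschitz_onI simp: dist_norm)
  then show ?thesis by (rule lipschitz_on_continuous_on)
qed

subsection \<open>The subdifferential sum rule\<close>

text \<open>From a relative interior point \<open>z\<close> the segment from \<open>u\<close>
  extends a little beyond \<open>z\<close> inside \<open>D\<close>; minimality at the extended point
  gives the reverse inequality.\<close>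

lemma linear_functional_constant_on_domain:
  fixes D :: "'a::euclidean_space set"
  assumes D: "convex D" "z \<in> rel_interior D" and min: "\<And>u. u \<in> D \<Longrightarrow> 0 \<le> a \<bullet> (u - z)" and u: "u \<in> D"
  shows "a \<bullet> (u - z) = 0"
proof -
  obtain e where e: "e > 1" "(1 - e) *\<^sub>R u + e *\<^sub>R z \<in> D"
    using convex_rel_interior_iff[of D z] D u by auto
  have "(1 - e) *\<^sub>R u + e *\<^sub>R z - z = (1 - e) *\<^sub>R (u - z)" by (simp add: algebra_simps)
  with min[OF e(2)] have "0 \<le> (1 - e) * (a \<bullet> (u - z))" by simp
  with e(1) have "a \<bullet> (u - z) \<le> 0" by (simp add: zero_le_mult_iff)
  with min[OF u] show ?thesis by simp
qed

lemma inner_bounded_above_imp_zero: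
  fixes a :: "'a::real_inner"
  assumes "\<And>x. a \<bullet> x \<le> b"
  shows "a = 0"
proof (rule ccontr)
  assume "a \<noteq> 0"
  then have "0 < a \<bullet> a" by simp
  moreover have "a \<bullet> (((\<bar>b\<bar> + 1) / (a \<bullet> a)) *\<^sub>R a) \<le> b" by (rule assms)
  ultimately show False by simp
qed

text \<open>
  The origin is separated from the convex set \<open>S\<close> below by a normal vector taken in the span of \<open>S\<close>;
  this is why relative interiors suffice in the qualification condition.
\<close>

lemma sum_rule_linear:
  fixes D :: "'n::finite \<Rightarrow> 'a::euclidean_space set" and r :: "'n \<Rightarrow> 'a \<Rightarrow> real"
  assumes r: "\<And>n. convex_on (D n) (r n)" and z: "\<And>n. z \<in> rel_interior (D n)"
    and x0: "\<And>n. x0 \<in> D n"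
    and min: "\<And>x. (\<And>n. x \<in> D n) \<Longrightarrow> (\<Sum>n\<in>UNIV. r n x0) + c \<bullet> x0 \<le> (\<Sum>n\<in>UNIV. r n x) + c \<bullet> x"
  shows "\<exists>h. (\<forall>n. \<forall>u\<in>D n. r n x0 + h n \<bullet> (u - x0) \<le> r n u) \<and> (\<Sum>n\<in>UNIV. h n) = - c"
proof -
  define v where "v = (\<Sum>n\<in>UNIV. r n x0) + c \<bullet> x0"
  \<comment> \<open>Strict epigraph of the value function of the perturbed problem in which block
    \<open>n\<close> is evaluated at \<open>w $ n + x\<close>, shifted by the optimal value.
    Minimality of \<open>x0\<close> says that the origin lies outside.\<close>
  define S where "S = {(w :: 'a ^ 'n, t :: real). \<exists>x. (\<forall>n. w $ n + x \<in> D n) \<and>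
    (\<Sum>n\<in>UNIV. r n (w $ n + x)) + c \<bullet> x - v < t}"
  have D: "convex (D n)" for n using r[of n] by (simp add: convex_on_def)
  have zD: "z \<in> D n" for n using z[of n] rel_interior_subset by blast
  have S_I: "((\<chi> n. u n - x), t) \<in> S"
    if "\<And>n. u n \<in> D n" "(\<Sum>n\<in>UNIV. r n (u n)) + c \<bullet> x - v < t" for u x t
    using that by (auto simp: S_def intro!: exI[of _ x])
  have "convex S"
    unfolding convex_alt
  proof clarify
    fix w1 w2 and t1 t2 s :: real
    assume "(w1, t1) \<in> S" "(w2, t2) \<in> S" and s: "0 \<le> s" "s \<le> 1"
    then obtain x1 x2 where 1: "\<And>n. w1 $ n + x1 \<in> D n" "(\<Sum>n\<in>UNIV. r n (w1 $ n + x1)) + c \<bullet> x1 - v < t1"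
      and 2: "\<And>n. w2 $ n + x2 \<in> D n" "(\<Sum>n\<in>UNIV. r n (w2 $ n + x2)) + c \<bullet> x2 - v < t2"
      by (auto simp: S_def)
    define w where "w = (1 - s) *\<^sub>R w1 + s *\<^sub>R w2"
    define x where "x = (1 - s) *\<^sub>R x1 + s *\<^sub>R x2"
    have eq: "w $ n + x = (1 - s) *\<^sub>R (w1 $ n + x1) + s *\<^sub>R (w2 $ n + x2)" for n
      by (simp add: w_def x_def algebra_simps)
    have "(\<Sum>n\<in>UNIV. r n (w $ n + x)) \<le>
        (\<Sum>n\<in>UNIV. (1 - s) * r n (w1 $ n + x1) + s * r n (w2 $ n + x2))"
      unfolding eq by (intro sum_mono convex_onD[OF r] s 1 2)
    also have "\<dots> = (1 - s) * (\<Sum>n\<in>UNIV. r n (w1 $ n + x1)) + s * (\<Sum>n\<in>UNIV. r n (w2 $ n + x2))"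
      by (simp add: sum.distrib sum_distrib_left)
    finally have "(\<Sum>n\<in>UNIV. r n (w $ n + x)) + c \<bullet> x - v \<le>
        (1 - s) * ((\<Sum>n\<in>UNIV. r n (w1 $ n + x1)) + c \<bullet> x1 - v)
        + s * ((\<Sum>n\<in>UNIV. r n (w2 $ n + x2)) + c \<bullet> x2 - v)"
      by (simp add: x_def inner_add_right algebra_simps)
    also have "\<dots> < (1 - s) * t1 + s * t2"
      using 1(2) 2(2) s by (cases "s = 0") (auto intro!: add_le_less_mono mult_left_mono)
    finally have "(\<Sum>n\<in>UNIV. r n (w $ n + x)) + c \<bullet> x - v < (1 - s) * t1 + s * t2" .
    moreover have "w $ n + x \<in> D n" for n
      unfolding eq by (intro convexD_alt D s 1 2)
    ultimately have "(w, (1 - s) * t1 + s * t2) \<in> S" by (auto simp: S_def)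
    then show "(1 - s) *\<^sub>R (w1, t1) + s *\<^sub>R (w2, t2) \<in> S" by (simp add: w_def)
  qed
  moreover have "S \<noteq> {}" using S_I[OF x0, of x0] lt_ex gt_ex by blast
  moreover have "0 \<notin> S"
  proof
    assume "0 \<in> S"
    then obtain x where "\<And>n. x \<in> D n" "(\<Sum>n\<in>UNIV. r n x) + c \<bullet> x - v < 0"
      by (auto simp: S_def zero_prod_def)
    with min[of x] show False by (simp add: v_def)
  qed
  ultimately obtain q b where q: "0 + q \<in> affine hull (insert 0 S)" "q \<noteq> 0" "q \<bullet> 0 \<le> b"
    "\<And>x. x \<in> S \<Longrightarrow> q \<bullet> x \<ge> b"
    by (rule separating_hyperplane_set_point_inaff) blast
  obtain a \<tau> where a\<tau>: "q = (a, \<tau>)" by (cases q)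
  have sep: "0 \<le> (\<Sum>n\<in>UNIV. a $ n \<bullet> (u n - x)) + \<tau> * t"
    if "\<And>n. u n \<in> D n" "(\<Sum>n\<in>UNIV. r n (u n)) + c \<bullet> x - v < t" for u x t
    using q(3) q(4)[OF S_I[OF that]] by (simp add: a\<tau> inner_prod_def inner_vec_def)
  have sum_a: "(\<Sum>n\<in>UNIV. a $ n \<bullet> (u - x)) = (\<Sum>n\<in>UNIV. a $ n) \<bullet> (u - x)" for u x
    by (simp add: inner_sum_left)
  have single: "(\<Sum>n\<in>UNIV. a $ n \<bullet> ((if n = m then u else y) - y)) = a $ m \<bullet> (u - y)" for m u y
  proof -
    have "(\<Sum>n\<in>UNIV. a $ n \<bullet> ((if n = m then u else y) - y)) =
      (\<Sum>n\<in>UNIV. if n = m then a $ m \<bullet> (u - y) else 0)" by (intro sum.cong) auto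
    then show ?thesis by simp
  qed
  \<comment> \<open>A vertical hyperplane is excluded: the free \<open>x\<close> forces the sum of
    the \<open>a $ n\<close> to vanish, and moving one block away from \<open>z\<close> shows that
    each \<open>a $ m\<close> is constant on \<open>D m\<close>. Then \<open>q\<close> is orthogonal
    to \<open>S\<close> while lying in its span.\<close>
  have "\<tau> \<noteq> 0"
  proof
    assume \<tau>: "\<tau> = 0"
    have sep0: "0 \<le> (\<Sum>n\<in>UNIV. a $ n \<bullet> (u n - x))" if "\<And>n. u n \<in> D n" for u x
      using sep[of u x "(\<Sum>n\<in>UNIV. r n (u n)) + c \<bullet> x - v + 1"] that by (simp add: \<tau>)
    have "(\<Sum>n\<in>UNIV. a $ n) \<bullet> x \<le> (\<Sum>n\<in>UNIV. a $ n) \<bullet> z" for x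
      using sep0[of "\<lambda>_. z" x] zD sum_a[of z x] by (simp add: inner_diff_right)
    then have a0: "(\<Sum>n\<in>UNIV. a $ n) = 0" by (rule inner_bounded_above_imp_zero)
    have const: "a $ m \<bullet> (u - z) = 0" if "u \<in> D m" for m u
    proof (rule linear_functional_constant_on_domain[OF D z _ that])
      fix u assume "u \<in> D m"
      then show "0 \<le> a $ m \<bullet> (u - z)"
        using sep0[of "\<lambda>n. if n = m then u else z" z] zD single[of m u z] by simp
    qed
    have "orthogonal q s" if s: "s \<in> S" for s
    proof -
      obtain w t where wt: "s = (w, t)" by (cases s)
      with s obtain x where x: "\<And>n. w $ n + x \<in> D n" by (auto simp: S_def)
      have "a \<bullet> w = (\<Sum>n\<in>UNIV. a $ n \<bullet> ((w $ n + x) - z) + a $ n \<bullet> (z - x))"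
        by (simp add: inner_vec_def flip: inner_add_right)
      also have "\<dots> = 0" by (simp add: sum.distrib const[OF x] sum_a a0)
      finally show ?thesis by (simp add: orthogonal_def a\<tau> wt \<tau> inner_prod_def)
    qed
    moreover have "q \<in> span S"
      using q(1) affine_hull_span_0[of "insert 0 S"] hull_inc[of 0 "insert 0 S" affine]
      by (simp add: span_insert_0)
    ultimately have "orthogonal q q" using orthogonal_to_span by blast
    with q(2) show False by (simp add: orthogonal_self)
  qed
  moreover have "0 \<le> \<tau>"
    using sep[of "\<lambda>_. x0" x0 1] x0 by (simp add: v_def)
  ultimately have \<tau>: "0 < \<tau>" by simp
  have sep_closed: "0 \<le> (\<Sum>n\<in>UNIV. a $ n \<bullet> (u n - x)) + \<tau> * ((\<Sum>n\<in>UNIV. r n (u n)) + c \<bullet> x - v)"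
    if u: "\<And>n. u n \<in> D n" for u x
  proof (rule field_le_epsilon)
    fix e :: real assume "0 < e"
    then show "0 \<le> (\<Sum>n\<in>UNIV. a $ n \<bullet> (u n - x)) + \<tau> * ((\<Sum>n\<in>UNIV. r n (u n)) + c \<bullet> x - v) + e"
      using sep[of u x "(\<Sum>n\<in>UNIV. r n (u n)) + c \<bullet> x - v + e / \<tau>"] u \<tau> by (simp add: distrib_left)
  qed
  \<comment> \<open>With all blocks at \<open>x0\<close> the separation bound is affine in the free
    \<open>x\<close>, so its slope is zero.\<close>
  have "((\<Sum>n\<in>UNIV. a $ n) - \<tau> *\<^sub>R c) \<bullet> x \<le> ((\<Sum>n\<in>UNIV. a $ n) - \<tau> *\<^sub>R c) \<bullet> x0" for x
    using sep_closed[of "\<lambda>_. x0" x] x0 sum_a[of x0 x]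
    by (simp add: v_def inner_diff_right inner_diff_left right_diff_distrib)
  then have "(\<Sum>n\<in>UNIV. a $ n) - \<tau> *\<^sub>R c = 0" by (rule inner_bounded_above_imp_zero)
  then have sum_eq: "(\<Sum>n\<in>UNIV. a $ n) = \<tau> *\<^sub>R c" by simp
  \<comment> \<open>Fixing \<open>x = x0\<close> and moving a single block \<open>u m\<close> turns
    the separation bound, divided by \<open>\<tau>\<close>, into the subgradient inequality for this
    vector.\<close>
  define h where "h n = - ((1 / \<tau>) *\<^sub>R a $ n)" for n
  have "r m x0 + h m \<bullet> (u - x0) \<le> r m u" if u: "u \<in> D m" for m u
  proof -
    have "(\<Sum>n\<in>UNIV. r n (if n = m then u else x0)) = r m u + (\<Sum>n\<in>UNIV - {m}. r n x0)"
      by (subst sum.remove[of _ m]) (auto intro!: sum.cong)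
    moreover have "(\<Sum>n\<in>UNIV. r n x0) = r m x0 + (\<Sum>n\<in>UNIV - {m}. r n x0)"
      by (rule sum.remove) auto
    ultimately have "0 \<le> a $ m \<bullet> (u - x0) + \<tau> * (r m u - r m x0)"
      using sep_closed[of "\<lambda>n. if n = m then u else x0" x0] x0 u single[of m u x0]
      by (simp add: v_def)
    then show ?thesis using \<tau> by (simp add: h_def field_simps)
  qed
  moreover have "(\<Sum>n\<in>UNIV. h n) = - c"
    using \<tau> by (simp add: h_def sum_negf sum_eq flip: scaleR_right.sum)
  ultimately show ?thesis by blast
qed

text \<open>Reduces optimality to the setting of the sum rule: the smooth part is replaced by one
  linear term.\<close>

lemma linearized_minimum:
  fixes f r :: "'n::finite \<Rightarrow> 'a::euclidean_space \<Rightarrow> real"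
  assumes f: "\<And>n x. GDERIV (f n) x :> grad (f n) x" and r: "\<And>n. convex_on (D n) (r n)"
    and x0: "\<And>n. x0 \<in> D n" and x: "\<And>n. x \<in> D n"
    and min: "\<And>x. (\<And>n. x \<in> D n) \<Longrightarrow> (\<Sum>n\<in>UNIV. f n x0 + r n x0) \<le> (\<Sum>n\<in>UNIV. f n x + r n x)"
  shows "(\<Sum>n\<in>UNIV. r n x0) + (\<Sum>n\<in>UNIV. grad (f n) x0) \<bullet> x0
    \<le> (\<Sum>n\<in>UNIV. r n x) + (\<Sum>n\<in>UNIV. grad (f n) x0) \<bullet> x"
proof (rule ccontr)
  assume contr: "\<not> ?thesis"
  define \<Delta> where "\<Delta> = (\<Sum>n\<in>UNIV. r n x) - (\<Sum>n\<in>UNIV. r n x0)"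
  \<comment> \<open>Up to a constant this majorizes the objective along the segment, with equality
    at 0, because each \<open>r n\<close> lies below its chord. If the claim failed, its derivative
    at 0 would be negative.\<close>
  define \<phi> where "\<phi> t = (\<Sum>n\<in>UNIV. f n (x0 + t *\<^sub>R (x - x0))) + t * \<Delta>" for t
  have "(\<phi> has_real_derivative (\<Sum>n\<in>UNIV. (x - x0) \<bullet> grad (f n) (x0 + 0 *\<^sub>R (x - x0))) + \<Delta>) (at 0)"
    unfolding \<phi>_def by (auto intro!: derivative_eq_intros DERIV_along_line f)
  moreover have "(\<Sum>n\<in>UNIV. (x - x0) \<bullet> grad (f n) (x0 + 0 *\<^sub>R (x - x0))) + \<Delta> < 0"
    using contr by (simp add: \<Delta>_def inner_commute[of "_ - _"] inner_diff_right sum_subtractf inner_sum_left)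
  ultimately obtain d where d: "d > 0" "\<And>t. 0 < t \<Longrightarrow> t < d \<Longrightarrow> \<phi> (0 + t) < \<phi> 0"
    using DERIV_neg_dec_right by blast
  define t where "t = min (d / 2) 1"
  have t: "0 < t" "t < d" "t \<le> 1" using d(1) by (auto simp: t_def)
  have line: "x0 + t *\<^sub>R (x - x0) = (1 - t) *\<^sub>R x0 + t *\<^sub>R x" by (simp add: algebra_simps)
  have "(\<Sum>n\<in>UNIV. f n x0 + r n x0) \<le> (\<Sum>n\<in>UNIV. f n (x0 + t *\<^sub>R (x - x0)) + r n (x0 + t *\<^sub>R (x - x0)))"
  proof (rule min)
    fix n show "x0 + t *\<^sub>R (x - x0) \<in> D n"
      unfolding line using r[of n] t by (intro convexD_alt x0 x) (auto simp: convex_on_def)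
  qed
  also have "\<dots> \<le> (\<Sum>n\<in>UNIV. f n (x0 + t *\<^sub>R (x - x0)) + ((1 - t) * r n x0 + t * r n x))"
    unfolding line using t by (intro sum_mono add_left_mono convex_onD[OF r] x0 x) auto
  also have "\<dots> = \<phi> t + (\<Sum>n\<in>UNIV. r n x0)"
    by (simp add: \<phi>_def \<Delta>_def sum.distrib algebra_simps sum_subtractf flip: sum_distrib_left)
  finally have "\<phi> 0 \<le> \<phi> t" by (simp add: \<phi>_def sum.distrib)
  with d(2)[of t] t show False by simp
qed

subsection \<open>The primal-dual operator\<close>

lemma avg_scaleR_add: "avg (\<chi> n. a n + c *\<^sub>R b n) = avg (\<chi> n. a n) + c *\<^sub>R avg (\<chi> n. b n)"
  by (simp add: avg_def sum.distrib scaleR_add_right scaleR_left_commute flip: scaleR_right.sum)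

lemma avg_const: "avg (\<chi> n::'n::finite. c) = c"
  by (simp add: avg_def sum_constant_scaleR)

lemma avg_diff: "avg (\<chi> n. a n - b n) = avg (\<chi> n. a n) - avg (\<chi> n. b n)"
  using avg_scaleR_add[of a "-1" b] by simp

lemma sum_eq_avg: "(\<Sum>n\<in>UNIV. a n) = real CARD('n) *\<^sub>R avg (\<chi> n::'n::finite. a n)"
  by (simp add: avg_def)

lemma continuous_on_avg [continuous_intros]:
  "(\<And>n. continuous_on A (\<lambda>z. a z n)) \<Longrightarrow> continuous_on A (\<lambda>z. avg (\<chi> n. a z n))"
  unfolding avg_def by (auto intro!: continuous_intros)

text \<open>Subtracting the mean is an orthogonal projection. Summed over the blocks, it satisfies
  with equality the inequality that proximity residuals satisfy in each block.\<close>

lemma sum_inner_deviation: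
  fixes d :: "'n::finite \<Rightarrow> 'a::euclidean_space"
  shows "(\<Sum>n\<in>UNIV. (norm (d n - avg (\<chi> m. d m)))\<^sup>2) = (\<Sum>n\<in>UNIV. (d n - avg (\<chi> m. d m)) \<bullet> d n)"
proof -
  let ?a = "avg (\<chi> m. d m)"
  have "(\<Sum>n\<in>UNIV. d n - ?a) = 0"
    by (simp add: sum_subtractf sum_eq_avg avg_const)
  then have "0 = (\<Sum>n\<in>UNIV. (d n - ?a)) \<bullet> ?a" by simp
  also have "\<dots> = (\<Sum>n\<in>UNIV. (d n - ?a) \<bullet> ?a)" by (rule inner_sum_left)
  also have "\<dots> = (\<Sum>n\<in>UNIV. (d n - ?a) \<bullet> d n) - (\<Sum>n\<in>UNIV. (norm (d n - ?a))\<^sup>2)"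
    by (simp add: power2_norm_eq_inner inner_diff_right sum_subtractf)
  finally show ?thesis by simp
qed

text \<open>
  The subtracted term uses up half of the dissipation \<open>l\<^sup>2 \<parallel>v + y\<parallel>\<^sup>2\<close>. Without it the operator is
  nonexpansive but not averaged when \<open>l = 1/2\<close>.
\<close>

definition block_energy :: "real \<Rightarrow> 'a::euclidean_space \<times> 'a \<times> 'a \<Rightarrow> real" where
  "block_energy l e = (case e of (v, y, x) \<Rightarrow>
     (norm x)\<^sup>2 + l * (norm v)\<^sup>2 + l * (norm y)\<^sup>2 - l\<^sup>2 / 2 * (norm (v + y))\<^sup>2)"

lemma norm_triple_power2: "(norm (v, y, x))\<^sup>2 = (norm v)\<^sup>2 + (norm y)\<^sup>2 + (norm x)\<^sup>2"
  by (simp add: norm_Pair)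

lemma norm_add_power2_le:
  fixes a b :: "'a::real_inner"
  shows "(norm (a + b))\<^sup>2 \<le> 2 * ((norm a)\<^sup>2 + (norm b)\<^sup>2)"
  using inner_ge_zero[of "a - b"]
  by (simp add: power2_norm_eq_inner inner_simps inner_commute)

lemma block_energy_bounds:
  assumes l: "0 < l" "l \<le> 1/2"
  shows "l / 2 * (norm e)\<^sup>2 \<le> block_energy l e" and "block_energy l e \<le> 1 * (norm e)\<^sup>2"
proof -
  obtain v y x where e: "e = (v, y, x)" by (cases e)
  let ?s = "(norm v)\<^sup>2 + (norm y)\<^sup>2"
  have "l\<^sup>2 / 2 * (norm (v + y))\<^sup>2 \<le> l\<^sup>2 / 2 * (2 * ?s)"
    using norm_add_power2_le[of v y] by (intro mult_left_mono) auto
  also have "\<dots> = l * (l * ?s)" by (simp add: power2_eq_square)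
  also have "\<dots> \<le> 1/2 * (l * ?s)" using l by (intro mult_right_mono) auto
  finally have 1: "l\<^sup>2 / 2 * (norm (v + y))\<^sup>2 \<le> l / 2 * ?s" by simp
  have 2: "l / 2 * (norm x)\<^sup>2 \<le> 1 * (norm x)\<^sup>2" using l by (intro mult_right_mono) auto
  show "l / 2 * (norm e)\<^sup>2 \<le> block_energy l e"
    using 1 2 by (simp add: e block_energy_def norm_triple_power2 field_simps)
  have "l * ?s \<le> 1 * ?s" using l by (intro mult_right_mono) auto
  moreover have "0 \<le> l\<^sup>2 / 2 * (norm (v + y))\<^sup>2" by simp
  ultimately show "block_energy l e \<le> 1 * (norm e)\<^sup>2"
    unfolding e block_energy_def norm_triple_power2 case_prod_conv distrib_left by linarith
qed

text \<open>\<open>(p, q, x)\<close> is the difference of a block to a fixed point before the step,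
  \<open>a\<close> and \<open>b\<close> are the differences of the new \<open>v\<close> and
  \<open>y\<close>, and \<open>d\<close> is the gradient difference. The inner product for
  \<open>a\<close> is carried along exactly, since it has no sign in a single block.\<close>

lemma block_energy_step:
  fixes w x p q a b d :: "'a::euclidean_space"
  assumes l: "0 < l" "l \<le> 1/2" and w: "w = x - \<gamma> *\<^sub>R d"
    and fwd: "(norm w)\<^sup>2 \<le> (norm x)\<^sup>2 - \<gamma> * (2 * \<beta> - \<gamma>) * (norm d)\<^sup>2"
    and b: "(norm b)\<^sup>2 \<le> b \<bullet> (w + (1 - l) *\<^sub>R q - l *\<^sub>R p)"
    and c: "0 < c" "c \<le> l / 8" "2 * c * \<gamma> \<le> 2 * \<beta> - \<gamma>" and \<gamma>: "0 < \<gamma>"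
  shows "block_energy l (a, b, w - l *\<^sub>R a - l *\<^sub>R b)
      + c * ((norm (a - p))\<^sup>2 + (norm (b - q))\<^sup>2 + (norm (w - l *\<^sub>R a - l *\<^sub>R b - x))\<^sup>2)
    \<le> block_energy l (p, q, x) - 2 * l * (a \<bullet> (w + (1 - l) *\<^sub>R p - l *\<^sub>R q) - (norm a)\<^sup>2)"
proof -
  define E where "E = (norm (a - p))\<^sup>2 + (norm (b - q))\<^sup>2"
  define R where "R = (norm (a + b - (p + q)))\<^sup>2"
  define G where "G = (norm d)\<^sup>2"
  define A where "A = (norm (a + b))\<^sup>2"
  define P where "P = (norm (p + q))\<^sup>2"
  define s where "s = a \<bullet> (w + (1 - l) *\<^sub>R p - l *\<^sub>R q) - (norm a)\<^sup>2"
  define r where "r = b \<bullet> (w + (1 - l) *\<^sub>R q - l *\<^sub>R p) - (norm b)\<^sup>2"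
  have nonneg: "0 \<le> E" "0 \<le> G" "0 \<le> A" "0 \<le> P" "0 \<le> r"
    using b by (simp_all add: E_def G_def A_def P_def r_def)
  \<comment> \<open>An identity; the estimates enter afterwards through \<open>fwd\<close>,
    \<open>0 \<le> r\<close> and the bounds on \<open>R\<close>.\<close>
  have expand: "block_energy l (a, b, w - l *\<^sub>R a - l *\<^sub>R b) =
      (norm w)\<^sup>2 + l * (norm p)\<^sup>2 + l * (norm q)\<^sup>2 - l\<^sup>2 * P - l * E + l\<^sup>2 * R - l\<^sup>2 / 2 * A
      - 2 * l * s - 2 * l * r"
    unfolding block_energy_def case_prod_conv E_def R_def A_def P_def s_def r_def power2_norm_eq_inner
    by (simp add: inner_simps inner_commute algebra_simps power2_eq_square)
  have "R \<le> 2 * E"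
    using norm_add_power2_le[of "a - p" "b - q"] by (simp add: R_def E_def algebra_simps)
  moreover have "R \<le> 2 * (A + P)"
    using norm_add_power2_le[of "a + b" "- (p + q)"] unfolding R_def A_def P_def norm_minus_cancel
    by (simp add: diff_conv_add_uminus del: add_uminus_conv_diff minus_add_distrib)
  \<comment> \<open>The two bounds are mixed with weights 7/8 and 1/8. At \<open>l = 1/2\<close> the
    first alone would consume all of \<open>l * E\<close>; the share of the second is charged to
    \<open>A\<close> and \<open>P\<close>, which the correction term of the energy makes
    available.\<close>
  ultimately have R: "R \<le> (A + P) / 4 + 7/4 * E" by argo
  have lR: "l\<^sup>2 * R \<le> l\<^sup>2 * ((A + P) / 4 + 7/4 * E)" using R by (intro mult_left_mono) auto
  have "l\<^sup>2 * (7/4 * E) \<le> l * (7/8 * E)"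
  proof -
    have "l * (l * (7/4 * E)) \<le> l * (1/2 * (7/4 * E))"
      using l nonneg by (intro mult_left_mono mult_right_mono) auto
    then show ?thesis by (simp add: power2_eq_square)
  qed
  moreover have "l\<^sup>2 * ((A + P) / 4 + 7/4 * E) = l\<^sup>2 * A / 4 + l\<^sup>2 * P / 4 + l\<^sup>2 * (7/4 * E)"
    by (simp add: algebra_simps add_divide_distrib)
  moreover have "l * (7/8 * E) = 7/8 * (l * E)" by simp
  ultimately have lR': "l\<^sup>2 * R \<le> l\<^sup>2 * A / 4 + l\<^sup>2 * P / 4 + 7/8 * (l * E)"
    using lR by linarith
  \<comment> \<open>The movement of \<open>x\<close> is paid for by the surplus of the forward step
    and by the remaining quarter of \<open>l\<^sup>2 * A\<close>.\<close>
  have "w - l *\<^sub>R a - l *\<^sub>R b - x = (- \<gamma>) *\<^sub>R d + (- l) *\<^sub>R (a + b)"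
    by (simp add: w algebra_simps)
  then have "(norm (w - l *\<^sub>R a - l *\<^sub>R b - x))\<^sup>2 \<le> 2 * ((norm ((- \<gamma>) *\<^sub>R d))\<^sup>2 + (norm ((- l) *\<^sub>R (a + b)))\<^sup>2)"
    by (simp only: norm_add_power2_le)
  also have "\<dots> = 2 * (\<gamma>\<^sup>2 * G + l\<^sup>2 * A)"
    by (simp add: G_def A_def power_mult_distrib)
  finally have "c * (norm (w - l *\<^sub>R a - l *\<^sub>R b - x))\<^sup>2 \<le> c * (2 * (\<gamma>\<^sup>2 * G + l\<^sup>2 * A))"
    using c by (intro mult_left_mono) auto
  moreover have "c * (2 * (\<gamma>\<^sup>2 * G)) \<le> \<gamma> * (2 * \<beta> - \<gamma>) * G"
  proof -
    have "(2 * c * \<gamma>) * (\<gamma> * G) \<le> (2 * \<beta> - \<gamma>) * (\<gamma> * G)"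
      using c \<gamma> nonneg by (intro mult_right_mono) auto
    then show ?thesis by (simp add: power2_eq_square mult_ac)
  qed
  moreover have "c * (2 * (l\<^sup>2 * A)) \<le> l\<^sup>2 * A / 4"
  proof -
    have "c * (2 * (l\<^sup>2 * A)) \<le> 1/8 * (2 * (l\<^sup>2 * A))"
      using c l nonneg by (intro mult_right_mono) auto
    then show ?thesis by (simp add: mult.commute)
  qed
  moreover have "c * E \<le> l / 8 * E" using c nonneg by (intro mult_right_mono) auto
  moreover have "0 \<le> l * r" "0 \<le> l\<^sup>2 * P" using l nonneg by auto
  moreover have "block_energy l (p, q, x) = (norm x)\<^sup>2 + l * (norm p)\<^sup>2 + l * (norm q)\<^sup>2 - l\<^sup>2 * P / 2"
    by (simp add: block_energy_def P_def)
  ultimately show ?thesis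
    using expand fwd lR' unfolding s_def[symmetric] E_def[symmetric] G_def[symmetric]
    by (simp add: distrib_left)
qed

section \<open>The operator on the product space and its energy decrease\<close>

locale primal_dual =
  fixes f :: "'n::finite \<Rightarrow> 'a::euclidean_space \<Rightarrow> real" and g :: "'n \<Rightarrow> 'a \<Rightarrow> ereal"
    and \<beta> \<gamma> lam :: real
  assumes \<beta>: "0 < \<beta>" and f_convex: "\<And>n. convex_on UNIV (f n)"
    and f_diff: "\<And>n. f n differentiable_on UNIV"
    and f_lipschitz: "\<And>n. (1 / \<beta>)-lipschitz_on UNIV (grad (f n))"
    and g: "\<And>n. g n \<in> Gamma0"
    and \<gamma>: "0 < \<gamma>" "\<gamma> < 2 * \<beta>" and lam: "0 < lam" "lam \<le> 1 / 2"
begin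

abbreviation "\<phi> n \<equiv> \<lambda>u. ereal (\<gamma> / lam) * g n u"

abbreviation "vpart z n \<equiv> fst (z $ n)"
abbreviation "ypart z n \<equiv> fst (snd (z $ n))"
abbreviation "xpart z n \<equiv> snd (snd (z $ n))"

definition forward :: "('a \<times> 'a \<times> 'a) ^ 'n \<Rightarrow> 'n \<Rightarrow> 'a" where
  "forward z n = xpart z n - \<gamma> *\<^sub>R grad (f n) (xpart z n)"

definition vpre :: "('a \<times> 'a \<times> 'a) ^ 'n \<Rightarrow> 'n \<Rightarrow> 'a" where
  "vpre z n = forward z n + (1 - lam) *\<^sub>R vpart z n - lam *\<^sub>R ypart z n"

definition ypre :: "('a \<times> 'a \<times> 'a) ^ 'n \<Rightarrow> 'n \<Rightarrow> 'a" where
  "ypre z n = forward z n + (1 - lam) *\<^sub>R ypart z n - lam *\<^sub>R vpart z n"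

text \<open>The residual of the projection onto \<open>consensus\<close>, that is, of the proximity
  operator of its indicator; \<open>ynew\<close> is the same construction for the functions
  \<open>g n\<close>.\<close>

definition vnew :: "('a \<times> 'a \<times> 'a) ^ 'n \<Rightarrow> 'n \<Rightarrow> 'a" where
  "vnew z n = vpre z n - avg (\<chi> m. vpre z m)"

definition ynew :: "('a \<times> 'a \<times> 'a) ^ 'n \<Rightarrow> 'n \<Rightarrow> 'a" where
  "ynew z n = ypre z n - prox (\<phi> n) (ypre z n)"

definition pd_step :: "('a \<times> 'a \<times> 'a) ^ 'n \<Rightarrow> ('a \<times> 'a \<times> 'a) ^ 'n" where
  "pd_step z = (\<chi> n. (vnew z n, ynew z n, forward z n - lam *\<^sub>R vnew z n - lam *\<^sub>R ynew z n))"

lemma f_GDERIV: "GDERIV (f n) x :> grad (f n) x"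
  by (rule GDERIV_grad[OF f_diff])

lemma \<phi>_Gamma0: "\<phi> n \<in> Gamma0"
  using \<gamma> lam by (intro Gamma0_scale g) simp

lemma continuous_on_pd_step: "continuous_on UNIV pd_step"
proof -
  have grad: "continuous_on UNIV (\<lambda>z. grad (f n) (h z))" if "continuous_on UNIV h" for h :: "('a \<times> 'a \<times> 'a) ^ 'n \<Rightarrow> 'a" and n
    by (rule continuous_on_compose2[OF lipschitz_on_continuous_on[OF f_lipschitz] that]) simp
  have prox: "continuous_on UNIV (\<lambda>z. prox (\<phi> n) (h z))" if "continuous_on UNIV h" for h :: "('a \<times> 'a \<times> 'a) ^ 'n \<Rightarrow> 'a" and n
    by (rule continuous_on_compose2[OF continuous_on_prox[OF \<phi>_Gamma0] that]) simp
  show ?thesis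
    unfolding pd_step_def vnew_def ynew_def vpre_def ypre_def forward_def
    by (intro continuous_intros continuous_on_vec_lambda grad prox)
qed

text \<open>The first bound is the eighth of \<open>lam * E\<close> left over in
  \<open>block_energy_step\<close>; the second is the surplus of the forward step, halved when the
  movement of \<open>x\<close> is split in two.\<close>

definition gap :: real where
  "gap = min (lam / 8) ((2 * \<beta> - \<gamma>) / (2 * \<gamma>))"

lemma gap: "0 < gap" "gap \<le> lam / 8" "2 * gap * \<gamma> \<le> 2 * \<beta> - \<gamma>"
proof -
  show "0 < gap" using \<gamma> lam by (simp add: gap_def)
  show "gap \<le> lam / 8" unfolding gap_def by (rule min.cobounded1)
  have "gap \<le> (2 * \<beta> - \<gamma>) / (2 * \<gamma>)" by (simp add: gap_def)
  then show "2 * gap * \<gamma> \<le> 2 * \<beta> - \<gamma>" using \<gamma> by (simp add: field_simps)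
qed

lemma pd_step_decrease:
  assumes fixed: "pd_step s = s"
  shows "(\<Sum>n\<in>UNIV. block_energy lam (pd_step z $ n - s $ n)) + gap * (norm (pd_step z - z))\<^sup>2
    \<le> (\<Sum>n\<in>UNIV. block_energy lam (z $ n - s $ n))"
proof -
  define a where "a n = vnew z n - vnew s n" for n
  define b where "b n = ynew z n - ynew s n" for n
  define w where "w n = forward z n - forward s n" for n
  define p where "p n = vpart z n - vpart s n" for n
  define q where "q n = ypart z n - ypart s n" for n
  define x where "x n = xpart z n - xpart s n" for n
  \<comment> \<open>The defect in the inequality for the \<open>v\<close>-update of block
    \<open>n\<close>. Its sign is unknown, but the defects sum to zero by
    \<open>sum_inner_deviation\<close>.\<close>
  define \<sigma> where "\<sigma> n = a n \<bullet> (w n + (1 - lam) *\<^sub>R p n - lam *\<^sub>R q n) - (norm (a n))\<^sup>2" for n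
  have s_n: "s $ n = (vnew s n, ynew s n, forward s n - lam *\<^sub>R vnew s n - lam *\<^sub>R ynew s n)" for n
    using arg_cong[OF fixed, of "\<lambda>z. z $ n"] by (simp add: pd_step_def)
  then have vs: "vpart s n = vnew s n" "ypart s n = ynew s n"
    "xpart s n = forward s n - lam *\<^sub>R vnew s n - lam *\<^sub>R ynew s n" for n by simp_all
  have step_n: "pd_step z $ n - s $ n = (a n, b n, w n - lam *\<^sub>R a n - lam *\<^sub>R b n)" for n
    by (subst s_n) (simp add: pd_step_def a_def b_def w_def algebra_simps)
  have z_n: "z $ n - s $ n = (p n, q n, x n)" for n
    by (simp add: p_def q_def x_def prod_eq_iff)
  have diff_n: "pd_step z $ n - z $ n = (a n - p n, b n - q n, w n - lam *\<^sub>R a n - lam *\<^sub>R b n - x n)" for n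
  proof -
    have "pd_step z $ n - z $ n = (pd_step z $ n - s $ n) - (z $ n - s $ n)" by simp
    then show ?thesis by (simp add: step_n z_n)
  qed
  have vpre_diff: "vpre z n - vpre s n = w n + (1 - lam) *\<^sub>R p n - lam *\<^sub>R q n" for n
    by (simp add: vpre_def w_def p_def q_def algebra_simps)
  have ypre_diff: "ypre z n - ypre s n = w n + (1 - lam) *\<^sub>R q n - lam *\<^sub>R p n" for n
    by (simp add: ypre_def w_def p_def q_def algebra_simps)
  have block: "block_energy lam (pd_step z $ n - s $ n) + gap * (norm (pd_step z $ n - z $ n))\<^sup>2
    \<le> block_energy lam (z $ n - s $ n) - 2 * lam * \<sigma> n" for n
    unfolding step_n z_n diff_n norm_triple_power2 add.assoc[symmetric] \<sigma>_def
  proof (rule block_energy_step[OF lam _ _ _ gap \<gamma>(1)])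
    show "w n = x n - \<gamma> *\<^sub>R (grad (f n) (xpart z n) - grad (f n) (xpart s n))"
      by (simp add: w_def x_def forward_def algebra_simps)
    show "(norm (w n))\<^sup>2 \<le> (norm (x n))\<^sup>2
        - \<gamma> * (2 * \<beta> - \<gamma>) * (norm (grad (f n) (xpart z n) - grad (f n) (xpart s n)))\<^sup>2"
      unfolding w_def x_def forward_def
      by (rule forward_step_bound[OF f_convex f_GDERIV \<beta> f_lipschitz \<gamma>(1)])
    show "(norm (b n))\<^sup>2 \<le> b n \<bullet> (w n + (1 - lam) *\<^sub>R q n - lam *\<^sub>R p n)"
      unfolding ypre_diff[symmetric] b_def ynew_def
      by (rule prox_residual_firmly_nonexpansive[OF \<phi>_Gamma0])
  qed
  have "a n = (vpre z n - vpre s n) - avg (\<chi> m. vpre z m - vpre s m)" for n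
    by (simp add: a_def vnew_def avg_diff)
  then have "(\<Sum>n\<in>UNIV. (norm (a n))\<^sup>2) = (\<Sum>n\<in>UNIV. a n \<bullet> (vpre z n - vpre s n))"
    using sum_inner_deviation[of "\<lambda>n. vpre z n - vpre s n"] by simp
  then have "(\<Sum>n\<in>UNIV. \<sigma> n) = 0"
    by (simp add: \<sigma>_def sum_subtractf vpre_diff)
  moreover have "(\<Sum>n\<in>UNIV. block_energy lam (pd_step z $ n - s $ n)) + gap * (norm (pd_step z - z))\<^sup>2
    \<le> (\<Sum>n\<in>UNIV. block_energy lam (z $ n - s $ n) - 2 * lam * \<sigma> n)"
    using sum_mono[of UNIV, OF block] by (simp add: norm_vec_power2 sum.distrib sum_distrib_left)
  ultimately show ?thesis by (simp add: sum_subtractf flip: sum_distrib_left)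
qed

section \<open>Fixed points of the operator and minimizers of the objective\<close>

abbreviation "gdom n \<equiv> eff_dom (g n)"
abbreviation "r n u \<equiv> real_of_ereal (g n u)"

lemma objective_finite:
  assumes "\<And>n. u \<in> gdom n"
  shows "objective f g u = ereal (\<Sum>n\<in>UNIV. f n u + r n u)"
proof -
  have "ereal (f n u) + g n u = ereal (f n u + r n u)" for n
    by (subst Gamma0_eff_dom[OF g assms]) simp
  then show ?thesis by (simp add: objective_def)
qed

lemma objective_infinite:
  assumes "u \<notin> gdom n"
  shows "objective f g u = \<infinity>"
  unfolding objective_def sum_Pinfty using not_eff_dom[OF assms] by auto

lemma minimizerI:
  assumes x: "\<And>n. x \<in> gdom n"
    and min: "\<And>u. (\<And>n. u \<in> gdom n) \<Longrightarrow> (\<Sum>n\<in>UNIV. f n x + r n x) \<le> (\<Sum>n\<in>UNIV. f n u + r n u)"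
  shows "minimizer (objective f g) x"
  unfolding minimizer_def is_arg_min_linorder
proof (intro conjI allI impI TrueI)
  fix u show "objective f g x \<le> objective f g u"
  proof (cases "\<forall>n. u \<in> gdom n")
    case True with x min show ?thesis by (simp add: objective_finite)
  qed (use objective_infinite in force)
qed

lemma product_minimizer:
  assumes "minimizer (objective f g) x"
  shows "minimizer (product_objective f g) (\<chi> n. x)"
  unfolding minimizer_def is_arg_min_linorder
proof (intro conjI allI impI TrueI)
  fix u :: "'a ^ 'n"
  have const: "product_objective f g (\<chi> n. y) = objective f g y" for y
    by (simp add: product_objective_def objective_def indicator_fun_def consensus_def)
  show "product_objective f g (\<chi> n. x) \<le> product_objective f g u"
  proof (cases "u \<in> consensus")
    case True
    then have "u = (\<chi> n. u $ undefined)" by (auto simp: consensus_def vec_eq_iff)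
    with assms const show ?thesis by (metis minimizer_def is_arg_min_linorder)
  next
    case False
    then have "indicator_fun consensus u = \<infinity>" by (simp add: indicator_fun_def)
    then show ?thesis by (simp add: product_objective_def)
  qed
qed

lemma is_subgradient_\<phi>:
  "is_subgradient (\<phi> n) x y \<longleftrightarrow> x \<in> gdom n \<and> (\<forall>u\<in>gdom n. r n x + (lam / \<gamma>) * (y \<bullet> (u - x)) \<le> r n u)"
proof -
  have c: "0 < \<gamma> / lam" using \<gamma> lam by simp
  have "eff_dom (\<phi> n) = gdom n"
    using c Gamma0_not_MInf[OF g, of n]
    by (auto simp: eff_dom_def ereal_mult_less_right ereal_mult_eq_PInfty less_top)
  moreover have "real_of_ereal (\<phi> n u) = \<gamma> / lam * r n u" for u by simp
  moreover have "\<gamma> / lam * r n x + y \<bullet> (u - x) \<le> \<gamma> / lam * r n u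
      \<longleftrightarrow> r n x + (lam / \<gamma>) * (y \<bullet> (u - x)) \<le> r n u" for u
  proof -
    have "\<gamma> / lam * r n x + y \<bullet> (u - x) = \<gamma> / lam * (r n x + (lam / \<gamma>) * (y \<bullet> (u - x)))"
      using \<gamma> lam by (simp add: distrib_left)
    then show ?thesis using mult_le_cancel_left_pos[OF c] by simp
  qed
  ultimately show ?thesis by (simp add: is_subgradient_def)
qed

text \<open>Stationarity of \<open>x\<close> turns the arguments of the two residual maps into
  \<open>x + v\<close> and \<open>x + y\<close>. Stationarity of \<open>v\<close> then yields
  consensus and zero sum of the \<open>v\<close>-parts, and that of \<open>y\<close> makes the
  \<open>y\<close>-parts subgradients.\<close>

lemma fixed_point_is_minimizer:
  assumes fixed: "pd_step z = z"
  shows "\<exists>x. (\<forall>n. xpart z n = x) \<and> minimizer (objective f g) x"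
proof -
  have z_n: "z $ n = (vnew z n, ynew z n, forward z n - lam *\<^sub>R vnew z n - lam *\<^sub>R ynew z n)" for n
    using arg_cong[OF fixed, of "\<lambda>z. z $ n"] by (simp add: pd_step_def)
  then have parts: "vpart z n = vnew z n" "ypart z n = ynew z n"
    and xp: "xpart z n = forward z n - lam *\<^sub>R vnew z n - lam *\<^sub>R ynew z n" for n by simp_all
  have vpre: "vpre z n = xpart z n + vpart z n" and ypre: "ypre z n = xpart z n + ypart z n" for n
    using xp[of n] by (simp_all add: vpre_def ypre_def parts algebra_simps)
  define x where "x = avg (\<chi> n. vpre z n)"
  have x: "xpart z n = x" for n
    using parts(1)[of n] vpre[of n] unfolding vnew_def x_def by (simp add: algebra_simps)
  have prox: "prox (\<phi> n) (ypre z n) = x" for n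
    using parts(2)[of n] ypre[of n] x[of n] unfolding ynew_def by (simp add: algebra_simps)
  have sub: "is_subgradient (\<phi> n) x (ypart z n)" for n
    using subgradient_prox[OF \<phi>_Gamma0, of n "ypre z n"] unfolding prox by (simp add: ypre x)
  have sum_v: "(\<Sum>n\<in>UNIV. vpart z n) = 0"
  proof -
    have "(\<chi> n. vpre z n) = (\<chi> n. x + 1 *\<^sub>R vpart z n)"
      by (simp add: vec_eq_iff vpre x)
    then have "x = avg (\<chi> n. x + 1 *\<^sub>R vpart z n)" using x_def by simp
    then have "avg (\<chi> n. vpart z n) = 0" unfolding avg_scaleR_add by (simp add: avg_const)
    then show ?thesis by (simp add: sum_eq_avg)
  qed
  have "\<gamma> *\<^sub>R grad (f n) x + (lam *\<^sub>R vpart z n + lam *\<^sub>R ypart z n) = 0" for n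
    using xp[of n] by (simp add: forward_def parts x algebra_simps)
  \<comment> \<open>Summing eliminates the \<open>v\<close>-parts and leaves the first-order
    condition for the sum.\<close>
  then have "(\<Sum>n\<in>UNIV. \<gamma> *\<^sub>R grad (f n) x + (lam *\<^sub>R vpart z n + lam *\<^sub>R ypart z n)) = 0" by simp
  then have "\<gamma> *\<^sub>R (\<Sum>n\<in>UNIV. grad (f n) x) = - (lam *\<^sub>R (\<Sum>n\<in>UNIV. ypart z n))"
    by (simp add: sum.distrib sum_v eq_neg_iff_add_eq_0 flip: scaleR_right.sum)
  then have "(1 / \<gamma>) *\<^sub>R (\<gamma> *\<^sub>R (\<Sum>n\<in>UNIV. grad (f n) x))
      = (1 / \<gamma>) *\<^sub>R - (lam *\<^sub>R (\<Sum>n\<in>UNIV. ypart z n))" by simp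
  then have grad_sum: "(\<Sum>n\<in>UNIV. grad (f n) x) = - ((lam / \<gamma>) *\<^sub>R (\<Sum>n\<in>UNIV. ypart z n))"
    using \<gamma> by simp
  have "minimizer (objective f g) x"
  proof (rule minimizerI)
    show "x \<in> gdom n" for n using sub[of n] by (simp add: is_subgradient_\<phi>)
    fix u assume u: "\<And>n. u \<in> gdom n"
    have "f n x + r n x + (grad (f n) x \<bullet> (u - x) + (lam / \<gamma>) * (ypart z n \<bullet> (u - x))) \<le> f n u + r n u" for n
      using convex_gradient_inequality[OF f_convex f_GDERIV, of n x u] sub[of n] u[of n]
      unfolding is_subgradient_\<phi> by force
    then have "(\<Sum>n\<in>UNIV. f n x + r n x + (grad (f n) x \<bullet> (u - x) + (lam / \<gamma>) * (ypart z n \<bullet> (u - x))))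
        \<le> (\<Sum>n\<in>UNIV. f n u + r n u)" by (intro sum_mono)
    moreover have "(\<Sum>n\<in>UNIV. grad (f n) x \<bullet> (u - x) + (lam / \<gamma>) * (ypart z n \<bullet> (u - x))) =
        ((\<Sum>n\<in>UNIV. grad (f n) x) + (lam / \<gamma>) *\<^sub>R (\<Sum>n\<in>UNIV. ypart z n)) \<bullet> (u - x)"
      by (simp add: sum.distrib inner_sum_left inner_add_left sum_distrib_left sum_divide_distrib)
    ultimately show "(\<Sum>n\<in>UNIV. f n x + r n x) \<le> (\<Sum>n\<in>UNIV. f n u + r n u)"
      by (simp add: sum.distrib grad_sum)
  qed
  with x show ?thesis by blast
qed

text \<open>The computation for fixed points run backwards: the sum rule supplies the
  \<open>y\<close>-parts.\<close>

lemma fixed_point_exists: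
  assumes attained: "\<exists>z. objective f g z = (INF u. objective f g u)"
    and qualification: "(\<Inter>n. rel_interior (gdom n)) \<noteq> {}"
  shows "\<exists>z. pd_step z = z"
proof -
  obtain x where "objective f g x = (INF u. objective f g u)" using attained by blast
  then have x_min: "objective f g x \<le> objective f g u" for u by (simp add: INF_lower)
  obtain y where y: "\<And>n. y \<in> rel_interior (gdom n)" using qualification by blast
  then have "y \<in> gdom n" for n using rel_interior_subset by blast
  then have "objective f g y < \<infinity>" by (simp add: objective_finite)
  with x_min[of y] have "objective f g x < \<infinity>" by (rule order.strict_trans1)
  then have x: "x \<in> gdom n" for n using objective_infinite[of x n] by auto
  have min: "(\<Sum>n\<in>UNIV. f n x + r n x) \<le> (\<Sum>n\<in>UNIV. f n u + r n u)" if "\<And>n. u \<in> gdom n" for u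
    using x_min[of u] that x by (simp add: objective_finite)
  let ?c = "\<Sum>n\<in>UNIV. grad (f n) x"
  have lin: "(\<Sum>n\<in>UNIV. r n x) + ?c \<bullet> x \<le> (\<Sum>n\<in>UNIV. r n u) + ?c \<bullet> u" if "\<And>n. u \<in> gdom n" for u
    by (rule linearized_minimum[OF f_GDERIV Gamma0_convex_on[OF g] x that min])
  have "\<exists>h. (\<forall>n. \<forall>u\<in>gdom n. r n x + h n \<bullet> (u - x) \<le> r n u) \<and> (\<Sum>n\<in>UNIV. h n) = - ?c"
    by (rule sum_rule_linear[OF Gamma0_convex_on[OF g] y x lin])
  then obtain h where h: "\<And>n u. u \<in> gdom n \<Longrightarrow> r n x + h n \<bullet> (u - x) \<le> r n u"
    and sum_h: "(\<Sum>n\<in>UNIV. h n) = - ?c" by blast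
  define Y where "Y n = (\<gamma> / lam) *\<^sub>R h n" for n
  \<comment> \<open>Chosen so that the \<open>x\<close>-equation holds in each block; the sum over
    the blocks vanishes by optimality of \<open>x\<close>.\<close>
  define V where "V n = - ((\<gamma> / lam) *\<^sub>R grad (f n) x) - Y n" for n
  define z where "z = (\<chi> n. (V n, Y n, x))"
  have fwd: "forward z n = x + lam *\<^sub>R V n + lam *\<^sub>R Y n" for n
    using lam by (simp add: forward_def z_def V_def algebra_simps)
  have vpre: "vpre z n = x + V n" and ypre: "ypre z n = x + Y n" for n
    unfolding vpre_def ypre_def fwd by (simp_all add: z_def algebra_simps)
  have "is_subgradient (\<phi> n) x (Y n)" for n
    unfolding is_subgradient_\<phi> using x h[of _ n] \<gamma> lam by (simp add: Y_def)
  then have ynew: "ynew z n = Y n" for n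
    unfolding ynew_def ypre by (subst prox_eqI[OF \<phi>_Gamma0]) auto
  have "(\<Sum>n\<in>UNIV. V n) = 0"
    by (simp add: V_def Y_def sum_subtractf sum_negf sum_h flip: scaleR_right.sum)
  then have "avg (\<chi> n. x + 1 *\<^sub>R V n) = x" unfolding avg_scaleR_add by (simp add: avg_const) (simp add: avg_def)
  then have vnew: "vnew z n = V n" for n by (simp add: vnew_def vpre)
  have "pd_step z = z"
    unfolding pd_step_def vnew ynew fwd by (simp add: z_def vec_eq_iff)
  then show ?thesis by blast
qed

text \<open>By linearity of \<open>avg\<close>, the vector
  \<open>s + (1 - lam) *\<^sub>R avg (v k)\<close> is the mean of the \<open>vpre\<close>, so the
  \<open>v\<close>-update of the algorithm is \<open>vnew\<close>.\<close>

lemma algorithm_eq_block_iterate: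
  assumes run: "smspdfp2o \<gamma> lam f g \<sigma> v y x"
  shows "(\<chi> n. (v k $ n, y k $ n, x k $ n))
    = block_iterate pd_step (\<chi> n. (v 0 $ n, y 0 $ n, x 0 $ n)) (hist \<sigma> k)"
proof (induction k)
  case (Suc k)
  define z where "z = (\<chi> n. (v k $ n, y k $ n, x k $ n))"
  have "(v (Suc k) $ n, y (Suc k) $ n, x (Suc k) $ n) = block_update pd_step (\<sigma> (Suc k)) z $ n" for n
  proof (cases "n = \<sigma> (Suc k)")
    case True
    have avg: "avg (\<chi> m. vpre z m) = avg (\<chi> m. x k $ m - \<gamma> *\<^sub>R grad (f m) (x k $ m) - lam *\<^sub>R y k $ m)
        + (1 - lam) *\<^sub>R avg (v k)"
    proof -
      have "(\<chi> m. vpre z m) = (\<chi> m. (x k $ m - \<gamma> *\<^sub>R grad (f m) (x k $ m) - lam *\<^sub>R y k $ m)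
          + (1 - lam) *\<^sub>R v k $ m)"
        by (simp add: vec_eq_iff vpre_def forward_def z_def)
      then show ?thesis by (simp only: avg_scaleR_add) simp
    qed
    show ?thesis
      using spec[OF spec[OF run[unfolded smspdfp2o_def], of k], of n] True
      by (simp add: Let_def block_update_def pd_step_def vnew_def ynew_def avg)
        (simp add: vpre_def ypre_def forward_def z_def)
  next
    case False
    then show ?thesis
      using spec[OF spec[OF run[unfolded smspdfp2o_def], of k], of n] by (simp add: block_update_def z_def)
  qed
  then show ?case using Suc by (simp add: z_def vec_eq_iff)
qed simp

end

theorem theorem4p2:
  fixes f :: "'n::finite \<Rightarrow> 'a::euclidean_space \<Rightarrow> real"
    and g :: "'n \<Rightarrow> 'a \<Rightarrow> ereal"
    and \<beta> \<gamma> lam :: real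
    and M :: "'w measure"
    and \<zeta> :: "nat \<Rightarrow> 'w \<Rightarrow> 'n"
    and v0 y0 x0 :: "'a ^ 'n"
    and v y x :: "nat \<Rightarrow> 'w \<Rightarrow> 'a ^ 'n"
  assumes "1 < CARD('n)"
    and "0 < \<beta>"
    and "\<And>n. convex_on UNIV (f n)"
    and "\<And>n. f n differentiable_on UNIV"
    and "\<And>n. (1 / \<beta>)-lipschitz_on UNIV (grad (f n))"
    and "\<And>n. g n \<in> Gamma0"
    and "\<exists>z. objective f g z = (INF u. objective f g u)"
    and "(\<Inter>n. rel_interior (eff_dom (g n))) \<noteq> {}"
    and "prob_space M"
    and "prob_space.indep_vars M (\<lambda>_. count_space UNIV) \<zeta> {1..}"
    and "\<And>k. 1 \<le> k \<Longrightarrow> distr M (count_space UNIV) (\<zeta> k) = distr M (count_space UNIV) (\<zeta> 1)"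
    and "\<And>n. 0 < measure M {\<omega> \<in> space M. \<zeta> 1 \<omega> = n}"
    and "0 < \<gamma>" and "\<gamma> < 2 * \<beta>"
    and "0 < lam" and "lam \<le> 1 / 2"
    and "\<And>\<omega>. \<omega> \<in> space M \<Longrightarrow> v 0 \<omega> = v0 \<and> y 0 \<omega> = y0 \<and> x 0 \<omega> = x0"
    and "\<And>\<omega>. \<omega> \<in> space M \<Longrightarrow>
           smspdfp2o \<gamma> lam f g (\<lambda>k. \<zeta> k \<omega>) (\<lambda>k. v k \<omega>) (\<lambda>k. y k \<omega>) (\<lambda>k. x k \<omega>)"
  shows "AE \<omega> in M.
           (\<exists>z. minimizer (objective f g) z \<and> (\<lambda>k. avg (x k \<omega>)) \<longlonglongrightarrow> z) \<and>
           (\<exists>z. minimizer (product_objective f g) z \<and> (\<lambda>k. \<chi> n. avg (x k \<omega>)) \<longlonglongrightarrow> z)"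
proof -
  interpret primal_dual f g \<beta> \<gamma> lam
    by unfold_locales (use assms in auto)
  interpret prob_space M by fact
  have meas: "\<zeta> k \<in> measurable M (count_space UNIV)" if "1 \<le> k" for k
    using assms(10) that unfolding indep_vars_def by auto
  interpret iid_selection M \<zeta> "\<lambda>n. measure M {\<omega> \<in> space M. \<zeta> 1 \<omega> = n}"
  proof
    show "indep_vars (\<lambda>_. count_space UNIV) \<zeta> {1..}" by fact
    fix k :: nat and n assume k: "1 \<le> k"
    \<comment> \<open>The common law is read off through its point masses.\<close>
    have "prob {\<omega> \<in> space M. \<zeta> k \<omega> = n} = measure (distr M (count_space UNIV) (\<zeta> k)) {n}" if "1 \<le> k" for k
      using meas[OF that] by (subst measure_distr) (auto simp: vimage_def Int_def conj_commute)
    with assms(11)[OF k] k show "prob {\<omega> \<in> space M. \<zeta> k \<omega> = n} = prob {\<omega> \<in> space M. \<zeta> 1 \<omega> = n}"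
      by simp
  qed
  define z0 where "z0 = (\<chi> n. (v0 $ n, y0 $ n, x0 $ n))"
  obtain s where s: "pd_step s = s" using fixed_point_exists assms(7,8) by blast
  have "AE \<omega> in M. \<exists>z. pd_step z = z \<and> (\<lambda>k. block_iterate pd_step z0 (history k \<omega>)) \<longlonglongrightarrow> z"
    using assms(12) lam
    by (intro block_iterate_converges[where Q = "block_energy lam" and m = "lam / 2" and K = 1 and c = gap and w = s]
        continuous_on_pd_step s block_energy_bounds gap pd_step_decrease) auto
  then show ?thesis
  proof (rule AE_mp, intro AE_I2 impI)
    fix \<omega> assume \<omega>: "\<omega> \<in> space M"
      and "\<exists>z. pd_step z = z \<and> (\<lambda>k. block_iterate pd_step z0 (history k \<omega>)) \<longlonglongrightarrow> z"
    then obtain z where z: "pd_step z = z" "(\<lambda>k. block_iterate pd_step z0 (history k \<omega>)) \<longlonglongrightarrow> z"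
      by blast
    obtain u where u: "\<And>n. xpart z n = u" "minimizer (objective f g) u"
      using fixed_point_is_minimizer[OF z(1)] by blast
    have run: "block_iterate pd_step z0 (history k \<omega>) = (\<chi> n. (v k \<omega> $ n, y k \<omega> $ n, x k \<omega> $ n))" for k
      using algorithm_eq_block_iterate[OF assms(18)[OF \<omega>], of k] assms(17)[OF \<omega>] by (simp add: z0_def)
    have "(\<lambda>k. snd (snd (block_iterate pd_step z0 (history k \<omega>) $ n))) \<longlonglongrightarrow> xpart z n" for n
      by (intro tendsto_intros z(2))
    then have x_lim: "(\<lambda>k. x k \<omega> $ n) \<longlonglongrightarrow> u" for n
      by (simp add: run u(1))
    have "(\<lambda>k. avg (x k \<omega>)) \<longlonglongrightarrow> (1 / real CARD('n)) *\<^sub>R (\<Sum>n\<in>(UNIV :: 'n set). u)"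
      unfolding avg_def by (intro tendsto_intros x_lim)
    then have lim: "(\<lambda>k. avg (x k \<omega>)) \<longlonglongrightarrow> u" by (simp add: sum_constant_scaleR)
    then have "(\<lambda>k. \<chi> n. avg (x k \<omega>)) \<longlonglongrightarrow> (\<chi> n. u)" by (intro tendsto_vec_lambda)
    with lim u(2) product_minimizer[OF u(2)]
    show "(\<exists>z. minimizer (objective f g) z \<and> (\<lambda>k. avg (x k \<omega>)) \<longlonglongrightarrow> z) \<and>
      (\<exists>z. minimizer (product_objective f g) z \<and> (\<lambda>k. \<chi> n. avg (x k \<omega>)) \<longlonglongrightarrow> z)" by blast
  qed
qed

end
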